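(* If $\mathscr{F}$ is a constructible cosheaf on $\mathbb{R}$ with set of critical values $S$, then $\mathfrak{D}(\mathscr{F})$ is a 1-dimensional CW-complex which is isomorphic (as an $\mathbb{R}$-space) to the display locale $\mathcal{D}(\mathscr{F})$ of $\mathscr{F}$.
   Context: Let $\mathbf{Int}$ be the category of (nonempty) connected open subsets of $\mathbb{R}$ ("open intervals") with inclusions. A pre-cosheaf on $\mathbb{R}$ is a functor $\mathscr{F}:\mathbf{Int}\to\mathbf{Set}$, with structure maps $\mathscr{F}[U\subset V]$. It is a cosheaf if $\varinjlim_{V\in\mathcal{V}}\mathscr{F}(V)=\mathscr{F}(U)$ (via the canonical map) for each open interval $U$ and each open interval cover $\mathcal{V}$ of $U$ closed under (nonempty) finite intersections. A cosheaf is constructible with set of critical values $S$ if $S\subset\mathbb{R}$ is finite and $\mathscr{F}[U\subset V]$ is an isomorphism for all open intervals $U\subset V$ with $S\cap U=S\cap V$. An $\mathbb{R}$-space is a topological space with a continuous map to $\mathbb{R}$; an isomorphism of $\mathbb{R}$-spaces is a homeomorphism commuting with the maps to $\mathbb{R}$. The costalk of $\mathscr{F}$ at $x$ is $\mathscr{F}_x=\varprojlim_{I\ni x}\mathscr{F}(I)$, the limit over open intervals $I$ containing $x$. The display locale is the set $\mathcal{D}(\mathscr{F})=\coprod_{x\in\mathbb{R}}\mathscr{F}_x$ with the topology generated by the sets $U_{I,a}=\{s\in\mathscr{F}_x:x\in I\text{ and }s\mapsto a\in\mathscr{F}(I)\}$ for $I\in\mathbf{Int}$, $a\in\mathscr{F}(I)$;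 its map to $\mathbb{R}$ sends $\mathscr{F}_x$ to $x$. Construction of $\mathfrak{D}(\mathscr{F})$. Let $\mathbb{R}_0=S$, $\mathbb{R}_1=\mathbb{R}\setminus\mathbb{R}_0$, and let $S_1$ be the set of connected components of $\mathbb{R}_1$. For $x\in\mathbb{R}_0$ let $I_x$ be the largest open interval containing $x$ with $I_x\cap\mathbb{R}_0=\{x\}$. Put $$\tilde{\mathfrak{D}}(\mathscr{F})=\coprod_{V\in S_1}\overline{V}\times\mathscr{F}(V)\ \sqcup\ \coprod_{x\in\mathbb{R}_0}\{x\}\times\mathscr{F}(I_x),$$ where $\overline V$ is the closure of $V$, the sets $\mathscr{F}(V),\mathscr{F}(I_x)$ are discrete, and the product with $\emptyset$ is empty. Let $\pi:\tilde{\mathfrak{D}}(\mathscr{F})\to\mathbb{R}$, $(x,a)\mapsto x$. For $x\in\mathbb{R}_0$ define $\psi_x:\pi^{-1}(x)\to\mathscr{F}(I_x)$ by $\psi_x(x,a)=\mathscr{F}[V\subset I_x](a)$ if $(x,a)\in\overline{V}\times\mathscr{F}(V)$ (then $V\subset I_x$), and $\psi_x(x,a)=a$ if $(x,a)\in\{x\}\times\mathscr{F}(I_x)$. Let $\sim$ be the equivalence relation generated by $(x,a)\sim(y,b)$ whenever $x=y\in\mathbb{R}_0$ and $\psi_x(x,a)=\psi_x(y,b)$. Then $\mathfrak{D}(\mathscr{F})=\tilde{\mathfrak{D}}(\mathscr{F})/\sim$ with the quotient topology and the map $\bar\pi:\mathfrak{D}(\mathscr{F})\to\mathbb{R}$ induced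 by $\pi$.
   Formalization: The isomorphism with the display locale is proved when, for x in S and V in I_x, all fibres of F[V⊂I_x] are finite; it fails otherwise (infinitely many rays glued at 0: the quotient is not first countable). "1-dimensional" means no cells of dimension above 1. *)

theory Defs
  imports "HOL-Analysis.Analysis"
begin

section \<open>Quotients\<close>

definition generated_equiv :: "'x set \<Rightarrow> ('x \<times> 'x) set \<Rightarrow> ('x \<times> 'x) set"
  where "generated_equiv A R = \<Inter>{r. equiv A r \<and> R \<subseteq> r}"

lemma equiv_generated_equiv:
  assumes "R \<subseteq> A \<times> A"
  shows "equiv A (generated_equiv A R)" and "R \<subseteq> generated_equiv A R"
proof -
  have "equiv A (A \<times> A)"
    by (auto simp: equiv_def refl_on_def sym_def trans_def)
  then have *: "generated_equiv A R \<subseteq> A \<times> A"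
    using assms unfolding generated_equiv_def by blast
  show "equiv A (generated_equiv A R)"
  proof (rule equivI)
    show "generated_equiv A R \<subseteq> A \<times> A" by (rule *)
    show "refl_on A (generated_equiv A R)"
      by (auto simp: generated_equiv_def refl_on_def equiv_def)
    show "sym (generated_equiv A R)"
      by (auto simp: generated_equiv_def sym_def equiv_def)
    show "trans (generated_equiv A R)"
      unfolding generated_equiv_def trans_def equiv_def by blast
  qed
  show "R \<subseteq> generated_equiv A R"
    by (auto simp: generated_equiv_def)
qed

definition quotient_topology :: "'x topology \<Rightarrow> ('x \<times> 'x) set \<Rightarrow> 'x set topology"
  where "quotient_topology X r =
    topology (\<lambda>\<U>. \<U> \<subseteq> topspace X // r \<and> openin X {x \<in> topspace X. r `` {x} \<in> \<U>})"

lemma openin_quotient_topology: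
  "openin (quotient_topology X r) \<U> \<longleftrightarrow>
     \<U> \<subseteq> topspace X // r \<and> openin X {x \<in> topspace X. r `` {x} \<in> \<U>}"
proof -
  have "istopology (\<lambda>\<U>. \<U> \<subseteq> topspace X // r \<and> openin X {x \<in> topspace X. r `` {x} \<in> \<U>})"
    unfolding istopology_def
  proof (intro conjI allI impI; (elim conjE)?)
    fix S T
    assume "openin X {x \<in> topspace X. r `` {x} \<in> S}" "openin X {x \<in> topspace X. r `` {x} \<in> T}"
    then have "openin X ({x \<in> topspace X. r `` {x} \<in> S} \<inter> {x \<in> topspace X. r `` {x} \<in> T})"
      by blast
    then show "openin X {x \<in> topspace X. r `` {x} \<in> S \<inter> T}"
      by (rule back_subst[where P = "openin X"]) blast
  next
    fix \<K>
    assume "\<forall>K\<in>\<K>. K \<subseteq> topspace X // r \<and> openin X {x \<in> topspace X. r `` {x} \<in> K}"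
    then have "openin X (\<Union>K\<in>\<K>. {x \<in> topspace X. r `` {x} \<in> K})"
      by blast
    then show "openin X {x \<in> topspace X. r `` {x} \<in> \<Union>\<K>}"
      by (rule back_subst[where P = "openin X"]) blast
  qed blast+
  then show ?thesis
    by (simp add: quotient_topology_def)
qed

lemma topspace_quotient_topology: "topspace (quotient_topology X r) = topspace X // r"
proof (rule antisym)
  show "topspace (quotient_topology X r) \<subseteq> topspace X // r"
    using openin_quotient_topology[of X r "topspace (quotient_topology X r)"] by simp
  have "{x \<in> topspace X. r `` {x} \<in> topspace X // r} = topspace X"
    by (auto simp: quotient_def)
  then have "openin (quotient_topology X r) (topspace X // r)"
    by (simp add: openin_quotient_topology)
  then show "topspace X // r \<subseteq> topspace (quotient_topology X r)"
    by (rule openin_subset)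
qed


section \<open>CW-complexes\<close>

text \<open>The closed ball, open ball and boundary sphere of Euclidean \<open>n\<close>-space; for \<open>n = 0\<close> the two
  balls are a single point and the sphere is empty.\<close>

definition cw_disk :: "nat \<Rightarrow> (nat \<Rightarrow> real) topology"
  where "cw_disk n = subtopology (Euclidean_space n) {x. (\<Sum>i<n. (x i)\<^sup>2) \<le> 1}"

definition cw_open_disk :: "nat \<Rightarrow> (nat \<Rightarrow> real) topology"
  where "cw_open_disk n = subtopology (Euclidean_space n) {x. (\<Sum>i<n. (x i)\<^sup>2) < 1}"

definition cw_sphere :: "nat \<Rightarrow> (nat \<Rightarrow> real) set"
  where "cw_sphere n = {x \<in> topspace (Euclidean_space n). (\<Sum>i<n. (x i)\<^sup>2) = 1}"

text \<open>Whitehead's definition: \<open>E\<close> is the set of open cells, \<open>d e\<close> the dimension and \<open>\<Phi> e\<close> the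
  characteristic map of \<open>e\<close>. The last two conjuncts are closure-finiteness and the weak topology.\<close>

definition cw_structure ::
    "'x topology \<Rightarrow> 'x set set \<Rightarrow> ('x set \<Rightarrow> nat) \<Rightarrow> ('x set \<Rightarrow> (nat \<Rightarrow> real) \<Rightarrow> 'x) \<Rightarrow> bool"
  where "cw_structure X E d \<Phi> \<longleftrightarrow>
    Hausdorff_space X \<and>
    \<Union>E = topspace X \<and> pairwise disjnt E \<and>
    (\<forall>e\<in>E. continuous_map (cw_disk (d e)) X (\<Phi> e) \<and>
           homeomorphic_map (cw_open_disk (d e)) (subtopology X e) (\<Phi> e)) \<and>
    (\<forall>e\<in>E. \<exists>T\<subseteq>E. finite T \<and> (\<forall>t\<in>T. d t < d e) \<and> \<Phi> e ` cw_sphere (d e) \<subseteq> \<Union>T) \<and>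
    (\<forall>A\<subseteq>topspace X. (\<forall>e\<in>E. closedin X (A \<inter> X closure_of e)) \<longrightarrow> closedin X A)"

text \<open>As is usual for graphs, an \<open>n\<close>-dimensional CW-complex is one without cells of dimension
  greater than \<open>n\<close>; cells of dimension exactly \<open>n\<close> need not occur.\<close>

definition cw_complex_of_dim :: "nat \<Rightarrow> 'x topology \<Rightarrow> bool"
  where "cw_complex_of_dim n X \<longleftrightarrow> (\<exists>E d \<Phi>. cw_structure X E d \<Phi> \<and> (\<forall>e\<in>E. d e \<le> n))"


section \<open>Spaces over the real line\<close>

definition R_space :: "'x topology \<Rightarrow> ('x \<Rightarrow> real) \<Rightarrow> bool"
  where "R_space X f \<longleftrightarrow> continuous_map X euclideanreal f"

definition R_space_isomorphic ::
    "'x topology \<Rightarrow> ('x \<Rightarrow> real) \<Rightarrow> 'y topology \<Rightarrow> ('y \<Rightarrow> real) \<Rightarrow> bool"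
  where "R_space_isomorphic X f Y g \<longleftrightarrow>
    R_space X f \<and> R_space Y g \<and>
    (\<exists>h. homeomorphic_map X Y h \<and> (\<forall>x\<in>topspace X. g (h x) = f x))"


section \<open>Constructible cosheaves on the real line\<close>

definition Int_cat :: "real set set"
  where "Int_cat = {U. open U \<and> connected U \<and> U \<noteq> {}}"

text \<open>A pre-cosheaf is given by the sets \<open>F U\<close> and the maps \<open>\<rho> U V\<close> for \<open>U \<subseteq> V\<close>. Only the values of
  \<open>F\<close> on \<open>Int_cat\<close> and of \<open>\<rho> U V\<close> on \<open>F U\<close> matter. The sets \<open>F U\<close> need not be disjoint; they are
  tagged with \<open>U\<close> wherever coproducts are formed.\<close>

definition precosheaf :: "(real set \<Rightarrow> 'a set) \<Rightarrow> (real set \<Rightarrow> real set \<Rightarrow> 'a \<Rightarrow> 'a) \<Rightarrow> bool"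
  where "precosheaf F \<rho> \<longleftrightarrow>
    (\<forall>U\<in>Int_cat. \<forall>V\<in>Int_cat. U \<subseteq> V \<longrightarrow> \<rho> U V \<in> F U \<rightarrow> F V) \<and>
    (\<forall>U\<in>Int_cat. \<forall>a\<in>F U. \<rho> U U a = a) \<and>
    (\<forall>U\<in>Int_cat. \<forall>V\<in>Int_cat. \<forall>W\<in>Int_cat. U \<subseteq> V \<longrightarrow> V \<subseteq> W \<longrightarrow>
       (\<forall>a\<in>F U. \<rho> V W (\<rho> U V a) = \<rho> U W a))"

definition colim_rel ::
    "(real set \<Rightarrow> 'a set) \<Rightarrow> (real set \<Rightarrow> real set \<Rightarrow> 'a \<Rightarrow> 'a) \<Rightarrow> real set set \<Rightarrow>
      ((real set \<times> 'a) \<times> (real set \<times> 'a)) set"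
  where "colim_rel F \<rho> \<V> = generated_equiv (Sigma \<V> F)
    {((V, a), (W, \<rho> V W a)) | V W a. V \<in> \<V> \<and> W \<in> \<V> \<and> V \<subseteq> W \<and> a \<in> F V}"

definition colim ::
    "(real set \<Rightarrow> 'a set) \<Rightarrow> (real set \<Rightarrow> real set \<Rightarrow> 'a \<Rightarrow> 'a) \<Rightarrow> real set set \<Rightarrow>
      (real set \<times> 'a) set set"
  where "colim F \<rho> \<V> = Sigma \<V> F // colim_rel F \<rho> \<V>"

text \<open>The canonical map to \<open>F U\<close>, for \<open>\<Union>\<V> \<subseteq> U\<close>: it is constant on each class by functoriality.\<close>

definition colim_map ::
    "(real set \<Rightarrow> real set \<Rightarrow> 'a \<Rightarrow> 'a) \<Rightarrow> real set \<Rightarrow> (real set \<times> 'a) set \<Rightarrow> 'a"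
  where "colim_map \<rho> U c = the_elem ((\<lambda>(V, a). \<rho> V U a) ` c)"

definition good_cover :: "real set \<Rightarrow> real set set \<Rightarrow> bool"
  where "good_cover U \<V> \<longleftrightarrow> \<V> \<subseteq> Int_cat \<and> \<Union>\<V> = U \<and>
    (\<forall>\<W>\<subseteq>\<V>. finite \<W> \<longrightarrow> \<W> \<noteq> {} \<longrightarrow> \<Inter>\<W> \<noteq> {} \<longrightarrow> \<Inter>\<W> \<in> \<V>)"

definition cosheaf :: "(real set \<Rightarrow> 'a set) \<Rightarrow> (real set \<Rightarrow> real set \<Rightarrow> 'a \<Rightarrow> 'a) \<Rightarrow> bool"
  where "cosheaf F \<rho> \<longleftrightarrow> precosheaf F \<rho> \<and>
    (\<forall>U\<in>Int_cat. \<forall>\<V>. good_cover U \<V> \<longrightarrow> bij_betw (colim_map \<rho> U) (colim F \<rho> \<V>) (F U))"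

definition constructible_cosheaf ::
    "(real set \<Rightarrow> 'a set) \<Rightarrow> (real set \<Rightarrow> real set \<Rightarrow> 'a \<Rightarrow> 'a) \<Rightarrow> real set \<Rightarrow> bool"
  where "constructible_cosheaf F \<rho> S \<longleftrightarrow> cosheaf F \<rho> \<and> finite S \<and>
    (\<forall>U\<in>Int_cat. \<forall>V\<in>Int_cat. U \<subseteq> V \<longrightarrow> S \<inter> U = S \<inter> V \<longrightarrow> bij_betw (\<rho> U V) (F U) (F V))"


section \<open>The display locale\<close>

text \<open>The limit over open intervals around \<open>x\<close>, as the set of compatible families \<open>s\<close>, where
  \<open>s I\<close> is the image of \<open>s\<close> in \<open>F I\<close>.\<close>

definition costalk ::
    "(real set \<Rightarrow> 'a set) \<Rightarrow> (real set \<Rightarrow> real set \<Rightarrow> 'a \<Rightarrow> 'a) \<Rightarrow> real \<Rightarrow> (real set \<Rightarrow> 'a) set"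
  where "costalk F \<rho> x =
    {s \<in> (\<Pi>\<^sub>E I\<in>{I \<in> Int_cat. x \<in> I}. F I).
       \<forall>I\<in>Int_cat. \<forall>J\<in>Int_cat. x \<in> I \<longrightarrow> I \<subseteq> J \<longrightarrow> \<rho> I J (s I) = s J}"

definition display_points ::
    "(real set \<Rightarrow> 'a set) \<Rightarrow> (real set \<Rightarrow> real set \<Rightarrow> 'a \<Rightarrow> 'a) \<Rightarrow> (real \<times> (real set \<Rightarrow> 'a)) set"
  where "display_points F \<rho> = Sigma UNIV (costalk F \<rho>)"

definition display_open ::
    "(real set \<Rightarrow> 'a set) \<Rightarrow> (real set \<Rightarrow> real set \<Rightarrow> 'a \<Rightarrow> 'a) \<Rightarrow> real set \<Rightarrow> 'a \<Rightarrow>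
      (real \<times> (real set \<Rightarrow> 'a)) set"
  where "display_open F \<rho> I a = {(x, s) \<in> display_points F \<rho>. x \<in> I \<and> s I = a}"

definition display_locale ::
    "(real set \<Rightarrow> 'a set) \<Rightarrow> (real set \<Rightarrow> real set \<Rightarrow> 'a \<Rightarrow> 'a) \<Rightarrow> (real \<times> (real set \<Rightarrow> 'a)) topology"
  where "display_locale F \<rho> =
    topology_generated_by {display_open F \<rho> I a | I a. I \<in> Int_cat \<and> a \<in> F I}"

lemma topspace_display_locale: "topspace (display_locale F \<rho>) = display_points F \<rho>"
proof -
  have U: "UNIV \<in> Int_cat"
    by (simp add: Int_cat_def)
  have "p \<in> \<Union>{display_open F \<rho> I a | I a. I \<in> Int_cat \<and> a \<in> F I}"
    if p: "p \<in> display_points F \<rho>" for p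
  proof -
    obtain x s where ps: "p = (x, s)" "s \<in> costalk F \<rho> x"
      using p by (auto simp: display_points_def)
    have "s UNIV \<in> F UNIV"
      using ps(2) U by (auto simp: costalk_def dest: PiE_mem)
    moreover have "p \<in> display_open F \<rho> UNIV (s UNIV)"
      using p ps by (simp add: display_open_def)
    ultimately show ?thesis
      using U by blast
  qed
  then show ?thesis
    unfolding display_locale_def topology_generated_by_topspace
    by (auto simp: display_open_def)
qed


section \<open>The geometric realization\<close>

definition edge_intervals :: "real set \<Rightarrow> real set set"
  where "edge_intervals S = components (UNIV - S)"

definition crit_interval :: "real set \<Rightarrow> real \<Rightarrow> real set"
  where "crit_interval S x = (GREATEST I. I \<in> Int_cat \<and> x \<in> I \<and> I \<inter> S = {x})"

lemma crit_interval_greatest: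
  assumes "finite S" "x \<in> S"
  shows "crit_interval S x \<in> Int_cat" "x \<in> crit_interval S x" "crit_interval S x \<inter> S = {x}"
    "\<And>J. J \<in> Int_cat \<Longrightarrow> x \<in> J \<Longrightarrow> J \<inter> S = {x} \<Longrightarrow> J \<subseteq> crit_interval S x"
proof -
  define M where "M = connected_component_set (- (S - {x})) x"
  have "open (- (S - {x}))"
    using assms(1) by (intro open_Compl finite_imp_closed) auto
  then have "open M"
    unfolding M_def by (rule open_connected_component)
  moreover have "x \<in> M"
    using assms(2) by (simp add: M_def connected_component_refl)
  moreover have "M \<subseteq> - (S - {x})"
    unfolding M_def by (rule connected_component_subset)
  moreover have "connected M"
    unfolding M_def by (rule connected_connected_component)
  ultimately have M: "M \<in> Int_cat" "x \<in> M" "M \<inter> S = {x}"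
    using assms(2) by (auto simp: Int_cat_def)
  have max: "J \<subseteq> M" if "J \<in> Int_cat" "x \<in> J" "J \<inter> S = {x}" for J
    unfolding M_def by (rule connected_component_maximal) (use that in \<open>auto simp: Int_cat_def\<close>)
  have "crit_interval S x = M"
    unfolding crit_interval_def by (rule Greatest_equality) (use M max in auto)
  with M max show "crit_interval S x \<in> Int_cat" "x \<in> crit_interval S x"
    "crit_interval S x \<inter> S = {x}"
    "\<And>J. J \<in> Int_cat \<Longrightarrow> x \<in> J \<Longrightarrow> J \<inter> S = {x} \<Longrightarrow> J \<subseteq> crit_interval S x"
    by auto
qed

text \<open>A point \<open>(Inl V, x, a)\<close> of the coproduct lies in \<open>closure V \<times> F V\<close>, and \<open>(Inr y, y, a)\<close> lies
  in \<open>{y} \<times> F (crit_interval S y)\<close>.\<close>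

type_synonym 'a pre_point = "(real set + real) \<times> real \<times> 'a"

definition pre_realization ::
    "(real set \<Rightarrow> 'a set) \<Rightarrow> real set \<Rightarrow> 'a pre_point topology"
  where "pre_realization F S = sum_topology
    (\<lambda>i. case i of
        Inl V \<Rightarrow> prod_topology (top_of_set (closure V)) (discrete_topology (F V))
      | Inr y \<Rightarrow> prod_topology (top_of_set {y}) (discrete_topology (F (crit_interval S y))))
    (edge_intervals S <+> S)"

definition pre_proj :: "'a pre_point \<Rightarrow> real"
  where "pre_proj p = (case p of (i, x, a) \<Rightarrow> x)"

text \<open>The maps \<open>\<psi>\<^sub>x\<close>, with \<open>x = pre_proj p\<close>; meaningful only for \<open>x \<in> S\<close>.\<close>

definition attach ::
    "(real set \<Rightarrow> real set \<Rightarrow> 'a \<Rightarrow> 'a) \<Rightarrow> real set \<Rightarrow> 'a pre_point \<Rightarrow> 'a"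
  where "attach \<rho> S p = (case p of (i, x, a) \<Rightarrow>
    (case i of Inl V \<Rightarrow> \<rho> V (crit_interval S x) a | Inr y \<Rightarrow> a))"

definition glue_rel ::
    "(real set \<Rightarrow> 'a set) \<Rightarrow> (real set \<Rightarrow> real set \<Rightarrow> 'a \<Rightarrow> 'a) \<Rightarrow> real set \<Rightarrow>
      ('a pre_point \<times> 'a pre_point) set"
  where "glue_rel F \<rho> S = generated_equiv (topspace (pre_realization F S))
    {(p, q). p \<in> topspace (pre_realization F S) \<and> q \<in> topspace (pre_realization F S) \<and>
       pre_proj p = pre_proj q \<and> pre_proj p \<in> S \<and> attach \<rho> S p = attach \<rho> S q}"

definition realization ::
    "(real set \<Rightarrow> 'a set) \<Rightarrow> (real set \<Rightarrow> real set \<Rightarrow> 'a \<Rightarrow> 'a) \<Rightarrow> real set \<Rightarrow>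
      'a pre_point set topology"
  where "realization F \<rho> S = quotient_topology (pre_realization F S) (glue_rel F \<rho> S)"

definition realization_proj :: "'a pre_point set \<Rightarrow> real"
  where "realization_proj c = the_elem (pre_proj ` c)"

text \<open>Each vertex of the realization meets only finitely many edges. If this fails at a vertex, the
  quotient topology is not first countable there, whereas the display locale has the countable
  neighbourhood basis formed by the sets \<open>display_open F \<rho> I a\<close> with \<open>I\<close> shrinking to the critical
  value.\<close>

definition finite_valence ::
    "(real set \<Rightarrow> 'a set) \<Rightarrow> (real set \<Rightarrow> real set \<Rightarrow> 'a \<Rightarrow> 'a) \<Rightarrow> real set \<Rightarrow> bool"
  where "finite_valence F \<rho> S \<longleftrightarrow>
    (\<forall>x\<in>S. \<forall>V\<in>edge_intervals S. V \<subseteq> crit_interval S x \<longrightarrow>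
       (\<forall>b\<in>F (crit_interval S x). finite {a \<in> F V. \<rho> V (crit_interval S x) a = b}))"

end

theory Submission
  imports Defs
begin

text \<open>Both spaces have the disjoint union of the sets \<open>F (star S x)\<close> as underlying set, where
  \<open>star S x\<close> is the largest open interval around \<open>x\<close> containing no critical value except possibly
  \<open>x\<close>. For the realization this is what the gluing achieves; for the display locale it holds because
  the intervals \<open>I\<close> around \<open>x\<close> with \<open>I \<subseteq> star S x\<close> are cofinal and \<open>F\<close> is constant on them. The
  bijection is continuous because along an edge the germs all come from one element over
  \<open>V \<inter> I\<close>. It is open because an element over a small interval around \<open>x\<close> determines the
  point over \<open>x\<close>, hence the finitely many edges that meet it.

  Distinct points over \<open>x\<close> have disjoint open stars, so the realization is Hausdorff.
  Cutting the edges at the integers makes all cells bounded, and the projection to the line inverts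
  the characteristic maps of the resulting arcs continuously.\<close>

section \<open>Graphs as CW-complexes\<close>

text \<open>Used for the weak topology, where closedness is known only over compact intervals
  between nearby vertices.\<close>

lemma closed_if_locally_closed_real:
  fixes B :: "real set"
  assumes "\<And>x. \<exists>l r. l < x \<and> x < r \<and> closed (B \<inter> {l..r})"
  shows "closed B"
  unfolding closed_def
proof (subst open_subopen, intro ballI)
  fix x
  assume x: "x \<in> - B"
  obtain l r where lr: "l < x" "x < r" "closed (B \<inter> {l..r})"
    using assms by blast
  have "open ({l<..<r} - B \<inter> {l..r})"
    using lr(3) by (intro open_Diff) auto
  moreover have "{l<..<r} - B \<inter> {l..r} \<subseteq> - B" "x \<in> {l<..<r} - B \<inter> {l..r}"
    using x lr by auto
  ultimately show "\<exists>T. open T \<and> x \<in> T \<and> T \<subseteq> - B"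
    by blast
qed

lemma Icc_subset_closure:
  fixes l r :: real
  assumes "l < r" "{l<..<r} \<subseteq> V"
  shows "{l..r} \<subseteq> closure V"
  using closure_mono[OF assms(2)] assms(1) by simp

lemma homeomorphic_map_cw_open_disk_0:
  assumes "c \<in> topspace X"
  shows "homeomorphic_map (cw_open_disk 0) (subtopology X {c}) (\<lambda>_. c)"
proof -
  \<comment> \<open>The zero sequence is the only point of \<open>Euclidean_space 0\<close>, so it
    is the value of the inverse.\<close>
  have "homeomorphic_maps (cw_open_disk 0) (subtopology X {c}) (\<lambda>_. c) (\<lambda>_ _. 0)"
    using assms
    by (auto simp: homeomorphic_maps_def cw_open_disk_def topspace_Euclidean_space
        continuous_map_in_subtopology fun_eq_iff)
  then show ?thesis
    using homeomorphic_map_maps by blast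
qed

lemma continuous_map_Euclidean_space_1_coord:
  "continuous_map (subtopology (Euclidean_space 1) A) euclideanreal (\<lambda>z. z 0)"
  unfolding Euclidean_space_def
  by (intro continuous_map_from_subtopology) (rule continuous_map_product_coordinates, simp)

text \<open>The projection \<open>f\<close> provides a continuous inverse of the characteristic map on the open cell.\<close>

lemma arc_characteristic_map:
  fixes l r :: real
  assumes lr: "l < r" and \<gamma>: "continuous_map (top_of_set {l..r}) X \<gamma>"
    and f: "continuous_map X euclideanreal f" "\<And>t. t \<in> {l..r} \<Longrightarrow> f (\<gamma> t) = t"
  obtains \<phi> where "continuous_map (cw_disk 1) X \<phi>"
    "homeomorphic_map (cw_open_disk 1) (subtopology X (\<gamma> ` {l<..<r})) \<phi>"
    "\<phi> ` cw_sphere 1 \<subseteq> {\<gamma> l, \<gamma> r}"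
proof -
  \<comment> \<open>\<open>u\<close> is the affine map of [-1, 1] onto \<open>{l..r}\<close>, read
    off coordinate 0. \<open>v\<close> is its inverse; its coordinates from 1 on vanish, as
    \<open>Euclidean_space 1\<close> demands.\<close>
  define u where "u z = (l + r) / 2 + (r - l) / 2 * z 0" for z :: "nat \<Rightarrow> real"
  define v where "v t i = (if i < 1 then (t - (l + r) / 2) / ((r - l) / 2) else 0)"
    for t and i :: nat
  have cont_u: "continuous_map (subtopology (Euclidean_space 1) A) euclideanreal u" for A
    unfolding u_def by (intro continuous_intros continuous_map_Euclidean_space_1_coord)
  have closed: "(l + r) / 2 + w \<in> {l..r}" if "\<bar>w\<bar> \<le> (r - l) / 2" for w
    using that by (auto simp: abs_if field_simps split: if_splits)
  have opened: "(l + r) / 2 + w \<in> {l<..<r}" if "\<bar>w\<bar> < (r - l) / 2" for w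
    using that by (auto simp: abs_if field_simps split: if_splits)
  have u_closed: "u z \<in> {l..r}" if "(z 0)\<^sup>2 \<le> 1" for z
  proof -
    have "\<bar>z 0\<bar> \<le> 1"
      using that abs_le_square_iff[of "z 0" 1] by simp
    then have "(r - l) / 2 * \<bar>z 0\<bar> \<le> (r - l) / 2"
      using lr by (simp add: mult_left_le)
    then have "\<bar>(r - l) / 2 * z 0\<bar> \<le> (r - l) / 2"
      using lr by (simp add: abs_mult)
    then show ?thesis
      unfolding u_def by (rule closed)
  qed
  have u_open: "u z \<in> {l<..<r}" if "(z 0)\<^sup>2 < 1" for z
  proof -
    have "\<bar>z 0\<bar> < 1"
      using that abs_square_less_1 by blast
    then have "(r - l) / 2 * \<bar>z 0\<bar> < (r - l) / 2"
      using lr by simp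
    then have "\<bar>(r - l) / 2 * z 0\<bar> < (r - l) / 2"
      using lr by (simp add: abs_mult)
    then show ?thesis
      unfolding u_def by (rule opened)
  qed
  have v_open: "(v t 0)\<^sup>2 < 1" if "t \<in> {l<..<r}" for t
  proof -
    have "\<bar>v t 0\<bar> < 1"
      using that by (auto simp: v_def abs_less_iff field_simps)
    then show ?thesis
      using abs_square_less_1 by blast
  qed
  have uv: "u (v t) = t" for t
    using lr by (simp add: u_def v_def field_simps)
  have vu: "v (u z) = z" if "z \<in> topspace (Euclidean_space 1)" for z
    using that lr by (auto simp: u_def v_def topspace_Euclidean_space fun_eq_iff field_simps)
  show ?thesis
  proof (rule that[of "\<gamma> \<circ> u"])
    have "continuous_map (cw_disk 1) (top_of_set {l..r}) u"
      using cont_u u_closed by (auto simp: continuous_map_in_subtopology cw_disk_def)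
    then show "continuous_map (cw_disk 1) X (\<gamma> \<circ> u)"
      using \<gamma> by (rule continuous_map_compose)
    have "continuous_map (cw_open_disk 1) (top_of_set {l..r}) u"
      using cont_u u_open
      by (auto simp: continuous_map_in_subtopology cw_open_disk_def less_imp_le)
    then have "continuous_map (cw_open_disk 1) X (\<gamma> \<circ> u)"
      using \<gamma> by (rule continuous_map_compose)
    then have "continuous_map (cw_open_disk 1) (subtopology X (\<gamma> ` {l<..<r})) (\<gamma> \<circ> u)"
      using u_open by (auto simp: continuous_map_in_subtopology cw_open_disk_def)
    moreover have "continuous_map X (Euclidean_space 1) (v \<circ> f)"
      unfolding comp_def v_def continuous_map_componentwise_Euclidean_space
      using f(1) lr by (auto intro!: continuous_intros)
    then have "continuous_map (subtopology X (\<gamma> ` {l<..<r})) (cw_open_disk 1) (v \<circ> f)"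
      using v_open f(2)
      by (auto simp: cw_open_disk_def continuous_map_in_subtopology continuous_map_from_subtopology)
    moreover have "(v \<circ> f) ((\<gamma> \<circ> u) z) = z" if "z \<in> topspace (cw_open_disk 1)" for z
      using that u_open[of z] vu[of z] f(2)[of "u z"] by (auto simp: cw_open_disk_def)
    moreover have "(\<gamma> \<circ> u) ((v \<circ> f) p) = p" if "p \<in> topspace (subtopology X (\<gamma> ` {l<..<r}))" for p
      using that uv f(2) by auto
    ultimately have
      "homeomorphic_maps (cw_open_disk 1) (subtopology X (\<gamma> ` {l<..<r})) (\<gamma> \<circ> u) (v \<circ> f)"
      unfolding homeomorphic_maps_def by blast
    then show "homeomorphic_map (cw_open_disk 1) (subtopology X (\<gamma> ` {l<..<r})) (\<gamma> \<circ> u)"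
      using homeomorphic_map_maps by blast
    have "u z \<in> {l, r}" if "z \<in> cw_sphere 1" for z
    proof -
      have "z 0 = 1 \<or> z 0 = - 1"
        using that power2_eq_1_iff[of "z 0"] by (simp add: cw_sphere_def)
      then show ?thesis
        unfolding u_def by (auto simp: field_simps)
    qed
    then show "(\<gamma> \<circ> u) ` cw_sphere 1 \<subseteq> {\<gamma> l, \<gamma> r}"
      by force
  qed
qed

text \<open>Each arc is given as a section of \<open>f\<close> over \<open>{l..r}\<close>, so
  \<open>arc_characteristic_map\<close> turns it into a characteristic map. Its boundary lies in two
  0-cells, which gives closure-finiteness.\<close>

lemma cw_complex_of_dim_1I:
  assumes "Hausdorff_space X" and union: "\<Union>E = topspace X" and "pairwise disjnt E"
    and f: "continuous_map X euclideanreal f"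
    and cells: "\<And>e. e \<in> E \<Longrightarrow> (\<exists>c. e = {c}) \<or>
      (\<exists>l r \<gamma>. l < r \<and> continuous_map (top_of_set {l..r}) X \<gamma> \<and> (\<forall>t\<in>{l..r}. f (\<gamma> t) = t) \<and>
        e = \<gamma> ` {l<..<r} \<and> {\<gamma> l} \<in> E \<and> {\<gamma> r} \<in> E)"
    and "\<And>A. A \<subseteq> topspace X \<Longrightarrow> (\<And>e. e \<in> E \<Longrightarrow> closedin X (A \<inter> X closure_of e)) \<Longrightarrow> closedin X A"
  shows "cw_complex_of_dim 1 X"
proof -
  \<comment> \<open>The dimension has to be a function of the cell as a set, so 0-cells are
    recognised as singletons; any other cell falls under the second case of
    \<open>cells\<close>.\<close>
  define d :: "'a set \<Rightarrow> nat" where "d e = (if \<exists>c. e = {c} then 0 else 1)" for e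
  define characteristic where "characteristic e \<phi> \<longleftrightarrow>
      (continuous_map (cw_disk (d e)) X \<phi> \<and>
        homeomorphic_map (cw_open_disk (d e)) (subtopology X e) \<phi>) \<and>
      (\<exists>T\<subseteq>E. finite T \<and> (\<forall>t\<in>T. d t < d e) \<and> \<phi> ` cw_sphere (d e) \<subseteq> \<Union>T)" for e \<phi>
  have "\<exists>\<phi>. characteristic e \<phi>"
    if e: "e \<in> E" for e
  proof (cases "\<exists>c. e = {c}")
    case True
    then obtain c where c: "e = {c}" by blast
    then have "c \<in> topspace X"
      using union e by blast
    \<comment> \<open>The empty sum is 0 and not 1, so a vertex has empty boundary and
      \<open>T\<close> can be empty.\<close>
    moreover have "cw_sphere 0 = {}"
      by (simp add: cw_sphere_def)
    ultimately show ?thesis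
      using c unfolding characteristic_def
      by (intro exI[of _ "\<lambda>_. c"] conjI exI[of _ "{}"]) (auto simp: d_def homeomorphic_map_cw_open_disk_0)
  next
    case False
    then obtain l r \<gamma> where \<gamma>: "l < r" "continuous_map (top_of_set {l..r}) X \<gamma>"
      "\<forall>t\<in>{l..r}. f (\<gamma> t) = t" "e = \<gamma> ` {l<..<r}" "{\<gamma> l} \<in> E" "{\<gamma> r} \<in> E"
      using cells[OF e] by metis
    obtain \<phi> where "continuous_map (cw_disk 1) X \<phi>"
      "homeomorphic_map (cw_open_disk 1) (subtopology X (\<gamma> ` {l<..<r})) \<phi>"
      "\<phi> ` cw_sphere 1 \<subseteq> {\<gamma> l, \<gamma> r}"
      using arc_characteristic_map[OF \<gamma>(1,2) f] \<gamma>(3) by auto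
    then show ?thesis
      using \<gamma>(4-6) False unfolding characteristic_def
      by (intro exI[of _ \<phi>] conjI exI[of _ "{{\<gamma> l}, {\<gamma> r}}"]) (auto simp: d_def)
  qed
  moreover define \<Phi> where "\<Phi> e = (SOME \<phi>. characteristic e \<phi>)" for e
  ultimately have "characteristic e (\<Phi> e)" if "e \<in> E" for e
    using someI_ex[of "characteristic e"] that by simp
  then have "cw_structure X E d \<Phi>"
    unfolding cw_structure_def by (intro conjI) (use assms in \<open>simp_all add: characteristic_def\<close>)
  moreover have "\<forall>e\<in>E. d e \<le> 1"
    by (simp add: d_def)
  ultimately show ?thesis
    unfolding cw_complex_of_dim_def by blast
qed


section \<open>Stars of points\<close>

text \<open>The critical interval of \<open>x\<close> if \<open>x \<in> S\<close>, and the edge interval containing \<open>x\<close> otherwise.\<close>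

definition star :: "real set \<Rightarrow> real \<Rightarrow> real set"
  where "star S x = connected_component_set (- (S - {x})) x"

lemma star_connected: "connected (star S x)"
  by (simp add: star_def)

lemma mem_star [simp]: "x \<in> star S x"
  by (simp add: star_def connected_component_refl)

lemma star_Int: "star S x \<inter> S = S \<inter> {x}"
  using connected_component_subset[of "- (S - {x})" x] mem_star[of x S] unfolding star_def
  by blast

lemma star_critical: "s \<in> star S x \<Longrightarrow> s \<in> S \<Longrightarrow> s = x"
  using star_Int[of S x] by auto

lemma star_maximal: "connected J \<Longrightarrow> x \<in> J \<Longrightarrow> J \<inter> S \<subseteq> {x} \<Longrightarrow> J \<subseteq> star S x"
  unfolding star_def by (rule connected_component_maximal) auto

text \<open>A critical \<open>y\<close> in the star of \<open>x\<close> is \<open>x\<close> itself.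
  Otherwise the union of the two stars is connected and contains no critical value except possibly
  \<open>x\<close>, so maximality applies.\<close>

lemma star_mono:
  assumes "y \<in> star S x"
  shows "star S y \<subseteq> star S x"
proof (cases "y \<in> S")
  case True
  then have "y = x"
    using assms star_Int by blast
  then show ?thesis by simp
next
  case False
  have "star S y \<union> star S x \<subseteq> star S x"
  proof (rule star_maximal)
    show "connected (star S y \<union> star S x)"
      by (rule connected_Un) (use assms mem_star[of y S] star_connected in blast)+
    show "(star S y \<union> star S x) \<inter> S \<subseteq> {x}"
      using star_Int[of S y] star_Int[of S x] False by auto
  qed auto
  then show ?thesis by simp
qed

lemma star_eq:
  assumes "y \<in> star S x" "x \<notin> S"
  shows "star S y = star S x"
proof
  show "star S y \<subseteq> star S x"
    using assms star_mono by blast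
  show "star S x \<subseteq> star S y"
    by (rule star_maximal) (use assms star_Int[of S x] star_connected in auto)
qed

lemma edge_interval_eq_star:
  assumes "V \<in> edge_intervals S" "x \<in> V"
  shows "star S x = V" and "x \<notin> S"
proof -
  show *: "x \<notin> S"
    using assms in_components_subset unfolding edge_intervals_def by blast
  then have "- (S - {x}) = UNIV - S"
    by auto
  moreover obtain y where "V = connected_component_set (UNIV - S) y"
    using assms(1) unfolding edge_intervals_def components_iff by blast
  ultimately show "star S x = V"
    using assms(2) connected_component_eq unfolding star_def by metis
qed

lemma star_in_edge_intervals:
  assumes "x \<notin> S"
  shows "star S x \<in> edge_intervals S"
proof -
  have "- (S - {x}) = UNIV - S"
    using assms by auto
  then show ?thesis
    using assms unfolding edge_intervals_def star_def by (auto simp: components_iff)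
qed

lemma star_in_Int_cat:
  assumes "finite S"
  shows "star S x \<in> Int_cat"
proof -
  have "open (- (S - {x}))"
    using assms by (intro open_Compl finite_imp_closed) auto
  then show ?thesis
    using mem_star[of x S] star_connected[of S x]
    unfolding Int_cat_def star_def by (blast intro: open_connected_component)
qed

lemma edge_in_Int_cat:
  assumes "finite S" "V \<in> edge_intervals S"
  shows "V \<in> Int_cat"
proof -
  have "V \<noteq> {}"
    using assms(2) in_components_nonempty unfolding edge_intervals_def by blast
  then show ?thesis
    using star_in_Int_cat[OF assms(1)] edge_interval_eq_star[OF assms(2)] by fastforce
qed

lemma edge_Int_critical: "V \<in> edge_intervals S \<Longrightarrow> V \<inter> S = {}"
  using edge_interval_eq_star(2) by blast

text \<open>Each side is the largest interval of its kind, which gives one inclusion each. Unlike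
  \<open>crit_interval\<close>, the star is also meaningful off \<open>S\<close>.\<close>

lemma crit_interval_eq_star:
  assumes "finite S" "x \<in> S"
  shows "crit_interval S x = star S x"
proof
  show "crit_interval S x \<subseteq> star S x"
    by (rule star_maximal) (use crit_interval_greatest[OF assms] in \<open>auto simp: Int_cat_def\<close>)
  show "star S x \<subseteq> crit_interval S x"
    by (rule crit_interval_greatest[OF assms])
      (use star_in_Int_cat star_Int[of S x] assms in auto)
qed

lemma edge_subset_star:
  assumes "finite S" "V \<in> edge_intervals S" "y \<in> V" "y \<in> star S x"
  shows "V \<subseteq> star S x"
  using star_mono[OF assms(4)] edge_interval_eq_star(1)[OF assms(2,3)] by simp

lemma edge_meets_open:
  assumes "x \<in> closure V" "open I" "x \<in> I"
  shows "I \<inter> V \<noteq> {}"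
  using assms open_Int_closure_eq_empty by blast

text \<open>The star is an open neighbourhood of \<open>x\<close> and hence meets \<open>V\<close>;
  a star that meets an edge contains it. For \<open>y = x\<close> this is the inclusion behind the
  map \<open>\<rho> V (star S x)\<close>, at the ends of \<open>V\<close> too.\<close>

lemma edge_subset_star_closure:
  assumes "finite S" "V \<in> edge_intervals S" "x \<in> closure V" "x \<in> star S y"
  shows "V \<subseteq> star S y"
proof -
  have "star S y \<inter> V \<noteq> {}"
    by (rule edge_meets_open) (use assms star_in_Int_cat[of S y] in \<open>auto simp: Int_cat_def\<close>)
  then show ?thesis
    using edge_subset_star assms by blast
qed

text \<open>The closure of an edge adds only critical values, so off \<open>S\<close> a point lies
  in the closure of just one edge.\<close>

lemma edge_eq_star:
  assumes "finite S" "V \<in> edge_intervals S" "x \<in> closure V" "x \<notin> S"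
  shows "V = star S x"
proof -
  have "V \<subseteq> star S x"
    using edge_subset_star_closure[OF assms(1-3)] by simp
  moreover obtain y where "y \<in> V"
    using assms(3) by fastforce
  ultimately show ?thesis
    using star_eq[of y S x] edge_interval_eq_star[OF assms(2)] assms(4) by auto
qed

lemma Int_in_Int_cat:
  assumes "I \<in> Int_cat" "J \<in> Int_cat" "I \<inter> J \<noteq> {}"
  shows "I \<inter> J \<in> Int_cat"
proof -
  have "connected (I \<inter> J)"
    using assms unfolding Int_cat_def is_interval_connected_1[symmetric]
    by (auto intro: is_interval_Int)
  then show ?thesis
    using assms by (auto simp: Int_cat_def)
qed


section \<open>The topology of the realization\<close>

text \<open>Singletons are open in the discrete factor, so a slice of \<open>W\<close> times its
  index \<open>{a}\<close> is an open box inside \<open>W\<close>.\<close>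

lemma openin_prod_discrete_topology:
  "openin (prod_topology X (discrete_topology A)) W \<longleftrightarrow>
     W \<subseteq> topspace X \<times> A \<and> (\<forall>a\<in>A. openin X {x. (x, a) \<in> W})"
proof safe
  fix x a
  assume W: "openin (prod_topology X (discrete_topology A)) W"
  then show "(x, a) \<in> W \<Longrightarrow> x \<in> topspace X" "(x, a) \<in> W \<Longrightarrow> a \<in> A"
    using openin_subset[OF W] by auto
next
  fix a
  assume W: "openin (prod_topology X (discrete_topology A)) W" and "a \<in> A"
  then have "openin X {x \<in> topspace X. (x, a) \<in> W}"
    by (intro openin_continuous_map_preimage[OF _ W]) (auto intro!: continuous_intros)
  moreover have "{x \<in> topspace X. (x, a) \<in> W} = {x. (x, a) \<in> W}"
    using openin_subset[OF W] by auto
  ultimately show "openin X {x. (x, a) \<in> W}"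
    by simp
next
  assume W: "W \<subseteq> topspace X \<times> A" "\<forall>a\<in>A. openin X {x. (x, a) \<in> W}"
  show "openin (prod_topology X (discrete_topology A)) W"
    unfolding openin_prod_topology_alt
  proof (intro allI impI)
    fix x a
    assume "(x, a) \<in> W"
    then show "\<exists>U V. openin X U \<and> openin (discrete_topology A) V \<and> x \<in> U \<and> a \<in> V \<and> U \<times> V \<subseteq> W"
      by (intro exI[of _ "{x. (x, a) \<in> W}"] exI[of _ "{a}"]) (use W in auto)
  qed
qed

lemma topspace_pre_realization:
  "p \<in> topspace (pre_realization F S) \<longleftrightarrow>
     (\<exists>V x a. p = (Inl V, x, a) \<and> V \<in> edge_intervals S \<and> x \<in> closure V \<and> a \<in> F V) \<or>
     (\<exists>x a. p = (Inr x, x, a) \<and> x \<in> S \<and> a \<in> F (crit_interval S x))"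
proof (cases p)
  case (fields i x a)
  then show ?thesis
    by (cases i) (auto simp: pre_realization_def)
qed

text \<open>Only the edge summands impose a condition: over a one-point base every slice is empty or
  everything.\<close>

lemma openin_pre_realization:
  "openin (pre_realization F S) W \<longleftrightarrow> W \<subseteq> topspace (pre_realization F S) \<and>
     (\<forall>V\<in>edge_intervals S. \<forall>a\<in>F V.
        openin (top_of_set (closure V)) {x. (Inl V, x, a) \<in> W})" (is "?L \<longleftrightarrow> ?R")
proof
  assume L: ?L
  have "openin (top_of_set (closure V)) {x. (Inl V, x, a) \<in> W}"
    if "V \<in> edge_intervals S" "a \<in> F V" for V a
    using L that unfolding pre_realization_def openin_sum_topology
    by (auto simp: openin_prod_discrete_topology dest!: bspec[of _ _ "Inl V"])
  then show ?R
    using openin_subset[OF L] by blast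
next
  assume R: ?R
  have "openin (top_of_set {y}) {x. (Inr y, x, a) \<in> W}" for y a
  proof -
    have "{x. (Inr y, x, a) \<in> W} \<subseteq> {y}"
      using R by (auto simp: subset_iff topspace_pre_realization)
    then show ?thesis
      by (metis openin_subtopology_self subset_singletonD openin_empty
          topspace_euclidean_subtopology openin_topspace)
  qed
  note Inr_open = this
  show ?L
    unfolding pre_realization_def openin_sum_topology
  proof (intro conjI ballI)
    show "W \<subseteq> Sigma (edge_intervals S <+> S) (topspace \<circ> (\<lambda>i. case i of
        Inl V \<Rightarrow> prod_topology (top_of_set (closure V)) (discrete_topology (F V))
      | Inr y \<Rightarrow> prod_topology (top_of_set {y}) (discrete_topology (F (crit_interval S y)))))"
      using R unfolding pre_realization_def topspace_sum_topology by blast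
    fix i
    assume i: "i \<in> edge_intervals S <+> S"
    show "openin (case i of
        Inl V \<Rightarrow> prod_topology (top_of_set (closure V)) (discrete_topology (F V))
      | Inr y \<Rightarrow> prod_topology (top_of_set {y}) (discrete_topology (F (crit_interval S y))))
      {x. (i, x) \<in> W}"
    proof (cases i)
      case (Inl V)
      have "{x. (Inl V, x) \<in> W} \<subseteq> closure V \<times> F V"
        using R by (force simp: topspace_pre_realization)
      then show ?thesis
        using R Inl i by (auto simp: openin_prod_discrete_topology)
    next
      case (Inr y)
      have "{x. (Inr y, x) \<in> W} \<subseteq> {y} \<times> F (crit_interval S y)"
        using R by (force simp: topspace_pre_realization)
      then show ?thesis
        using Inr_open Inr by (auto simp: openin_prod_discrete_topology)
    qed
  qed
qed

section \<open>Functoriality, constructibility and the points of the realization\<close>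

locale constructible_cosheaf_data =
  fixes F :: "real set \<Rightarrow> 'a set"
    and \<rho> :: "real set \<Rightarrow> real set \<Rightarrow> 'a \<Rightarrow> 'a"
    and S :: "real set"
  assumes constr: "constructible_cosheaf F \<rho> S"
begin

lemma finite_S: "finite S"
  using constr by (simp add: constructible_cosheaf_def)

lemmas star_Int_cat = star_in_Int_cat[OF finite_S]
lemmas edge_Int_cat = edge_in_Int_cat[OF finite_S]

lemma precosh: "precosheaf F \<rho>"
  using constr by (simp add: constructible_cosheaf_def cosheaf_def)

lemma \<rho>_closed: "U \<in> Int_cat \<Longrightarrow> V \<in> Int_cat \<Longrightarrow> U \<subseteq> V \<Longrightarrow> a \<in> F U \<Longrightarrow> \<rho> U V a \<in> F V"
  using precosh unfolding precosheaf_def by (metis funcset_mem)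

lemma \<rho>_id: "U \<in> Int_cat \<Longrightarrow> a \<in> F U \<Longrightarrow> \<rho> U U a = a"
  using precosh unfolding precosheaf_def by metis

lemma \<rho>_comp:
  "U \<in> Int_cat \<Longrightarrow> V \<in> Int_cat \<Longrightarrow> W \<in> Int_cat \<Longrightarrow> U \<subseteq> V \<Longrightarrow> V \<subseteq> W \<Longrightarrow> a \<in> F U \<Longrightarrow>
     \<rho> V W (\<rho> U V a) = \<rho> U W a"
  using precosh unfolding precosheaf_def by metis

lemma \<rho>_bij:
  "U \<in> Int_cat \<Longrightarrow> V \<in> Int_cat \<Longrightarrow> U \<subseteq> V \<Longrightarrow> S \<inter> U = S \<inter> V \<Longrightarrow> bij_betw (\<rho> U V) (F U) (F V)"
  using constr unfolding constructible_cosheaf_def by blast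

text \<open>The map \<open>p \<mapsto> (pre_proj p, fibre_value p)\<close> identifies the quotient set with the disjoint union of
  the sets \<open>F (star S x)\<close>; a point of the realization is one of its fibres.\<close>

definition fibre_value :: "'a pre_point \<Rightarrow> 'a"
  where "fibre_value p = (case p of (i, x, a) \<Rightarrow>
    (case i of Inl V \<Rightarrow> \<rho> V (star S x) a | Inr y \<Rightarrow> a))"

definition point :: "real \<Rightarrow> 'a \<Rightarrow> 'a pre_point set"
  where "point x b = {p \<in> topspace (pre_realization F S). pre_proj p = x \<and> fibre_value p = b}"

lemma edge_value_in:
  assumes "V \<in> edge_intervals S" "a \<in> F V" "x \<in> closure V"
  shows "\<rho> V (star S x) a \<in> F (star S x)"
  by (rule \<rho>_closed[OF edge_Int_cat[OF assms(1)] star_Int_cat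
        edge_subset_star_closure[OF finite_S assms(1,3) mem_star] assms(2)])

lemma fibre_value_in:
  assumes "p \<in> topspace (pre_realization F S)"
  shows "fibre_value p \<in> F (star S (pre_proj p))"
  using assms edge_value_in
  by (auto simp: topspace_pre_realization fibre_value_def pre_proj_def crit_interval_eq_star[OF finite_S])

lemma fibre_value_edge:
  assumes "V \<in> edge_intervals S" "x \<in> V" "a \<in> F V"
  shows "\<rho> V (star S x) a = a"
  using edge_interval_eq_star(1)[OF assms(1,2)] assms \<rho>_id edge_Int_cat by simp

text \<open>Over a critical value the summand \<open>{x} \<times> F (crit_interval S x)\<close>
  represents every \<open>b\<close>, even one that no edge reaches. Elsewhere
  \<open>star S x\<close> is itself an edge through \<open>x\<close>.\<close>

lemma point_nonempty:
  assumes "b \<in> F (star S x)"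
  obtains p where "p \<in> topspace (pre_realization F S)" "pre_proj p = x" "fibre_value p = b"
proof (cases "x \<in> S")
  case True
  then have "(Inr x, x, b) \<in> topspace (pre_realization F S)"
    using assms by (simp add: topspace_pre_realization crit_interval_eq_star[OF finite_S])
  then show ?thesis
    by (rule that) (auto simp: pre_proj_def fibre_value_def)
next
  case False
  have "(Inl (star S x), x, b) \<in> topspace (pre_realization F S)"
    using assms star_in_edge_intervals[OF False] closure_subset[of "star S x"] mem_star[of x S]
    by (auto simp: topspace_pre_realization)
  then show ?thesis
    by (rule that) (use assms in \<open>auto simp: pre_proj_def fibre_value_def \<rho>_id star_Int_cat\<close>)
qed

text \<open>Since \<open>b\<close> is a genuine value, the fibre \<open>point x b\<close> is
  nonempty, and any member of it reveals both coordinates.\<close>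

lemma point_inj:
  assumes "b \<in> F (star S x)" "point x b = point y c"
  shows "x = y" "b = c"
proof -
  obtain p where "p \<in> topspace (pre_realization F S)" "pre_proj p = x" "fibre_value p = b"
    using assms(1) by (rule point_nonempty)
  then have "p \<in> point y c"
    using assms(2) by (auto simp: point_def)
  then show "x = y" "b = c"
    using \<open>pre_proj p = x\<close> \<open>fibre_value p = b\<close> by (auto simp: point_def)
qed

text \<open>Off \<open>S\<close> the edge is forced to be \<open>star S x\<close>, and
  \<open>\<rho> V V\<close> is the identity, so base point and fibre value recover the
  pre-point.\<close>

lemma pre_point_eq:
  assumes "p \<in> topspace (pre_realization F S)" "q \<in> topspace (pre_realization F S)"
    "pre_proj p = pre_proj q" "pre_proj p \<notin> S" "fibre_value p = fibre_value q"
  shows "p = q"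
proof -
  have *: "p = (Inl (star S (pre_proj p)), pre_proj p, fibre_value p)"
    if "p \<in> topspace (pre_realization F S)" "pre_proj p \<notin> S" for p :: "'a pre_point"
    using that edge_eq_star[OF finite_S] \<rho>_id[OF edge_Int_cat]
    by (auto simp: topspace_pre_realization pre_proj_def fibre_value_def)
  show ?thesis
    using assms *[of p] *[of q] by simp
qed

lemma attach_eq_fibre_value:
  assumes "pre_proj p \<in> S"
  shows "attach \<rho> S p = fibre_value p"
  using assms
  by (auto simp: attach_def fibre_value_def pre_proj_def crit_interval_eq_star[OF finite_S]
    split: prod.splits sum.splits)

text \<open>The right-hand side is an equivalence relation that contains the generating pairs.
  Conversely, its pairs over \<open>S\<close> are generators, because \<open>attach\<close> and
  \<open>fibre_value\<close> agree there, and its pairs off \<open>S\<close> are diagonal by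
  \<open>pre_point_eq\<close>.\<close>

lemma glue_rel_eq:
  "glue_rel F \<rho> S = {(p, q). p \<in> topspace (pre_realization F S) \<and>
     q \<in> topspace (pre_realization F S) \<and> pre_proj p = pre_proj q \<and> fibre_value p = fibre_value q}"
  (is "_ = ?K")
proof
  let ?X = "topspace (pre_realization F S)"
  let ?R = "{(p, q). p \<in> ?X \<and> q \<in> ?X \<and> pre_proj p = pre_proj q \<and> pre_proj p \<in> S \<and>
    attach \<rho> S p = attach \<rho> S q}"
  have "equiv ?X ?K"
    by (rule equivI) (auto simp: refl_on_def sym_def trans_def)
  moreover have "?R \<subseteq> ?K"
    using attach_eq_fibre_value by fastforce
  ultimately show "glue_rel F \<rho> S \<subseteq> ?K"
    unfolding glue_rel_def generated_equiv_def by blast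
  have R: "?R \<subseteq> ?X \<times> ?X"
    by auto
  show "?K \<subseteq> glue_rel F \<rho> S"
  proof safe
    fix p q :: "'a pre_point"
    assume pq: "p \<in> ?X" "q \<in> ?X" "pre_proj p = pre_proj q" "fibre_value p = fibre_value q"
    show "(p, q) \<in> glue_rel F \<rho> S"
    proof (cases "pre_proj p \<in> S")
      case True
      then have "(p, q) \<in> ?R"
        using pq attach_eq_fibre_value[of p] attach_eq_fibre_value[of q] by simp
      then show ?thesis
        using equiv_generated_equiv(2)[OF R] unfolding glue_rel_def by blast
    next
      case False
      then have "p = q"
        using pq pre_point_eq by blast
      then show ?thesis
        using equiv_generated_equiv(1)[OF R] pq unfolding glue_rel_def equiv_def refl_on_def
        by blast
    qed
  qed
qed

lemma class_eq_point:
  assumes "p \<in> topspace (pre_realization F S)"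
  shows "glue_rel F \<rho> S `` {p} = point (pre_proj p) (fibre_value p)"
  using assms by (auto simp: glue_rel_eq point_def)

lemma topspace_realization:
  "topspace (realization F \<rho> S) = {point x b | x b. b \<in> F (star S x)}"
proof -
  have "topspace (realization F \<rho> S) =
      (\<lambda>p. point (pre_proj p) (fibre_value p)) ` topspace (pre_realization F S)"
    unfolding realization_def topspace_quotient_topology
    by (auto simp: quotient_def class_eq_point)
  also have "\<dots> = {point x b | x b. b \<in> F (star S x)}"
  proof (rule subset_antisym; rule subsetI)
    fix c
    assume "c \<in> {point x b | x b. b \<in> F (star S x)}"
    then obtain x b where "c = point x b" "b \<in> F (star S x)"
      by blast
    moreover obtain p where "p \<in> topspace (pre_realization F S)" "pre_proj p = x" "fibre_value p = b"
      using \<open>b \<in> F (star S x)\<close> by (rule point_nonempty)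
    ultimately show "c \<in> (\<lambda>p. point (pre_proj p) (fibre_value p)) ` topspace (pre_realization F S)"
      by (auto intro!: image_eqI[of _ _ p])
  qed (use fibre_value_in in blast)
  finally show ?thesis .
qed

lemma point_in_topspace: "b \<in> F (star S x) \<Longrightarrow> point x b \<in> topspace (realization F \<rho> S)"
  unfolding topspace_realization by blast

text \<open>The image of the slice \<open>closure V \<times> {a}\<close> under the quotient map,
  written through its fibre values.\<close>

definition edge_path :: "real set \<Rightarrow> 'a \<Rightarrow> real \<Rightarrow> 'a pre_point set"
  where "edge_path V a x = point x (\<rho> V (star S x) a)"

lemma edge_path_in_topspace:
  assumes "V \<in> edge_intervals S" "a \<in> F V" "x \<in> closure V"
  shows "edge_path V a x \<in> topspace (realization F \<rho> S)"
  unfolding edge_path_def by (rule point_in_topspace) (rule edge_value_in[OF assms])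

text \<open>The preimage of \<open>U\<close> in the coproduct is tested on edge slices only, so the
  realization carries the final topology for all edge paths. Later arguments about its open and
  closed sets reduce to this form.\<close>

lemma openin_realization:
  "openin (realization F \<rho> S) U \<longleftrightarrow> U \<subseteq> topspace (realization F \<rho> S) \<and>
     (\<forall>V\<in>edge_intervals S. \<forall>a\<in>F V.
        openin (top_of_set (closure V)) {x \<in> closure V. edge_path V a x \<in> U})"
proof -
  have *: "{x. (Inl V, x, a) \<in> {p \<in> topspace (pre_realization F S). glue_rel F \<rho> S `` {p} \<in> U}} =
      {x \<in> closure V. edge_path V a x \<in> U}" if "V \<in> edge_intervals S" "a \<in> F V" for V a
    using that
    by (auto simp: class_eq_point topspace_pre_realization pre_proj_def fibre_value_def edge_path_def)
  show ?thesis
    unfolding realization_def openin_quotient_topology openin_pre_realization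
      topspace_quotient_topology
    using * by auto
qed

lemma closedin_realization:
  "closedin (realization F \<rho> S) A \<longleftrightarrow> A \<subseteq> topspace (realization F \<rho> S) \<and>
     (\<forall>V\<in>edge_intervals S. \<forall>a\<in>F V.
        closedin (top_of_set (closure V)) {x \<in> closure V. edge_path V a x \<in> A})"
proof -
  have "closure V - {x \<in> closure V. edge_path V a x \<in> A} =
      {x \<in> closure V. edge_path V a x \<in> topspace (realization F \<rho> S) - A}"
    if "V \<in> edge_intervals S" "a \<in> F V" for V a
    using edge_path_in_topspace[OF that] by auto
  then show ?thesis
    unfolding closedin_def openin_realization by auto
qed

lemma continuous_edge_path:
  assumes "V \<in> edge_intervals S" "a \<in> F V"
  shows "continuous_map (top_of_set (closure V)) (realization F \<rho> S) (edge_path V a)"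
  unfolding continuous_map_def
  using assms edge_path_in_topspace openin_realization by auto

lemma realization_proj_point:
  assumes "b \<in> F (star S x)"
  shows "realization_proj (point x b) = x"
proof -
  obtain p where "p \<in> topspace (pre_realization F S)" "pre_proj p = x" "fibre_value p = b"
    using assms by (rule point_nonempty)
  then have "p \<in> point x b"
    by (simp add: point_def)
  moreover have "\<And>q. q \<in> point x b \<Longrightarrow> pre_proj q = x"
    by (simp add: point_def)
  ultimately have "pre_proj ` point x b = {x}"
    by blast
  then show ?thesis
    by (simp add: realization_proj_def)
qed

lemma realization_proj_edge_path:
  assumes "V \<in> edge_intervals S" "a \<in> F V" "x \<in> closure V"
  shows "realization_proj (edge_path V a x) = x"
  unfolding edge_path_def using edge_value_in[OF assms] by (rule realization_proj_point)

lemma continuous_realization_proj: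
  "continuous_map (realization F \<rho> S) euclideanreal realization_proj"
  unfolding continuous_map_def
proof (intro conjI allI impI)
  fix U :: "real set"
  assume "openin euclideanreal U"
  then have "open U" by simp
  have "{x \<in> closure V. edge_path V a x \<in>
      {c \<in> topspace (realization F \<rho> S). realization_proj c \<in> U}} = closure V \<inter> U"
    if "V \<in> edge_intervals S" "a \<in> F V" for V a
    using that edge_path_in_topspace realization_proj_edge_path by auto
  then show "openin (realization F \<rho> S) {c \<in> topspace (realization F \<rho> S). realization_proj c \<in> U}"
    unfolding openin_realization using \<open>open U\<close> by (auto simp: openin_open_Int)
qed auto

section \<open>Open stars and the Hausdorff property\<close>

definition point_star :: "real \<Rightarrow> 'a \<Rightarrow> 'a pre_point set set"
  where "point_star x b =
    {point y c | y c. y \<in> star S x \<and> c \<in> F (star S y) \<and> \<rho> (star S y) (star S x) c = b}"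

text \<open>For critical \<open>x\<close> the set is the vertex \<open>point x b\<close> with the
  open edges attached to it. By functoriality an edge with value \<open>a\<close> belongs to it
  exactly over \<open>star S x\<close> if \<open>a\<close> maps to \<open>b\<close>, and nowhere
  otherwise.\<close>

lemma openin_point_star: "openin (realization F \<rho> S) (point_star x b)"
  unfolding openin_realization
proof (intro conjI ballI)
  show "point_star x b \<subseteq> topspace (realization F \<rho> S)"
    by (auto simp: point_star_def intro: point_in_topspace)
  fix V a
  assume V: "V \<in> edge_intervals S" "a \<in> F V"
  have "edge_path V a y \<in> point_star x b \<longleftrightarrow> y \<in> star S x \<and> \<rho> V (star S x) a = b"
    if y: "y \<in> closure V" for y
  proof -
    have "edge_path V a y \<in> point_star x b \<longleftrightarrow>
        y \<in> star S x \<and> \<rho> (star S y) (star S x) (\<rho> V (star S y) a) = b"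
      unfolding point_star_def edge_path_def
      using edge_value_in[OF V y] point_inj[OF edge_value_in[OF V y]] by blast
    moreover have "\<rho> (star S y) (star S x) (\<rho> V (star S y) a) = \<rho> V (star S x) a"
      if "y \<in> star S x"
      by (rule \<rho>_comp) (use V y that star_mono[OF that] edge_subset_star_closure[OF finite_S V(1) y, of y]
        edge_Int_cat star_Int_cat in auto)
    ultimately show ?thesis by auto
  qed
  then have "{y \<in> closure V. edge_path V a y \<in> point_star x b} =
      closure V \<inter> (if \<rho> V (star S x) a = b then star S x else {})"
    by auto
  then show "openin (top_of_set (closure V)) {y \<in> closure V. edge_path V a y \<in> point_star x b}"
    using star_Int_cat[of x] by (auto simp: Int_cat_def openin_open_Int)
qed

text \<open>Points over different reals are separated by the projection. Over one real, the stars of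
  different values are disjoint: a common point would have a single value, whose image in
  \<open>F (star S x)\<close> is both \<open>b\<close> and \<open>c\<close>.\<close>

lemma Hausdorff_realization: "Hausdorff_space (realization F \<rho> S)"
  unfolding Hausdorff_space_def
proof (intro allI impI, elim conjE)
  let ?X = "realization F \<rho> S"
  fix p q
  assume "p \<in> topspace ?X" "q \<in> topspace ?X" "p \<noteq> q"
  then obtain x b y c where p: "p = point x b" "b \<in> F (star S x)"
    and q: "q = point y c" "c \<in> F (star S y)"
    unfolding topspace_realization by auto
  show "\<exists>U V. openin ?X U \<and> openin ?X V \<and> p \<in> U \<and> q \<in> V \<and> disjnt U V"
  proof (cases "x = y")
    case False
    then obtain A B where AB: "open A" "open B" "x \<in> A" "y \<in> B" "A \<inter> B = {}"
      using hausdorff[OF False] by metis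
    have op: "openin ?X {c \<in> topspace ?X. realization_proj c \<in> W}" if "open W" for W
      by (rule openin_continuous_map_preimage[OF continuous_realization_proj]) (use that in simp)
    have "p \<in> {c \<in> topspace ?X. realization_proj c \<in> A}"
      "q \<in> {c \<in> topspace ?X. realization_proj c \<in> B}"
      using AB p q realization_proj_point point_in_topspace by simp_all
    moreover have "disjnt {c \<in> topspace ?X. realization_proj c \<in> A}
        {c \<in> topspace ?X. realization_proj c \<in> B}"
      using AB(5) unfolding disjnt_iff by blast
    ultimately show ?thesis
      using op[OF AB(1)] op[OF AB(2)] by blast
  next
    case True
    have self: "point x d \<in> point_star x d" if "d \<in> F (star S x)" for d
      using \<rho>_id[OF star_Int_cat that] that mem_star[of x S] unfolding point_star_def by blast
    have "disjnt (point_star x b) (point_star x c)"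
      unfolding disjnt_iff
    proof safe
      fix r
      assume "r \<in> point_star x b" "r \<in> point_star x c"
      then obtain u d v e where
        "r = point u d" "d \<in> F (star S u)" "\<rho> (star S u) (star S x) d = b"
        "r = point v e" "\<rho> (star S v) (star S x) e = c"
        unfolding point_star_def by blast
      then have "b = c"
        using point_inj[of d u v e] by simp
      then show False
        using p q True \<open>p \<noteq> q\<close> by simp
    qed
    moreover have "p \<in> point_star x b" "q \<in> point_star x c"
      using self p q True by simp_all
    ultimately show ?thesis
      using openin_point_star by blast
  qed
qed

section \<open>Comparison with the display locale\<close>

lemma star_Int_in_Int_cat:
  assumes "I \<in> Int_cat" "x \<in> I"
  shows "I \<inter> star S x \<in> Int_cat"
  using assms star_Int_cat mem_star[of x S] by (intro Int_in_Int_cat) auto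

text \<open>Shrinking the star to \<open>I\<close> keeps \<open>x\<close>, the only possible
  critical value in it, so constructibility applies.\<close>

lemma \<rho>_star_bij:
  assumes "I \<in> Int_cat" "x \<in> I"
  shows "bij_betw (\<rho> (I \<inter> star S x) (star S x)) (F (I \<inter> star S x)) (F (star S x))"
proof (rule \<rho>_bij)
  show "S \<inter> (I \<inter> star S x) = S \<inter> star S x"
    using assms(2) star_critical by auto
qed (use assms star_Int_in_Int_cat star_Int_cat in auto)

text \<open>As \<open>\<rho> (I \<inter> star S x) (star S x)\<close> is bijective, an element of the costalk at \<open>x\<close> is
  determined by its component over \<open>star S x\<close>.\<close>

definition germ :: "real \<Rightarrow> 'a \<Rightarrow> real set \<Rightarrow> 'a"
  where "germ x b = (\<lambda>I\<in>{I \<in> Int_cat. x \<in> I}.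
    \<rho> (I \<inter> star S x) I (inv_into (F (I \<inter> star S x)) (\<rho> (I \<inter> star S x) (star S x)) b))"

text \<open>Pushing \<open>w\<close> into \<open>F (I \<inter> star S x)\<close> yields the unique
  preimage that \<open>inv_into\<close> selects. The interval \<open>K\<close> may miss
  \<open>x\<close>, as the part of an edge near its end point does.\<close>

lemma germ_\<rho>:
  assumes I: "I \<in> Int_cat" "x \<in> I" and K: "K \<in> Int_cat" "K \<subseteq> I" "K \<subseteq> star S x" "w \<in> F K"
  shows "germ x (\<rho> K (star S x) w) I = \<rho> K I w"
proof -
  let ?J = "I \<inter> star S x"
  have J: "?J \<in> Int_cat"
    using I by (rule star_Int_in_Int_cat)
  have "\<rho> ?J (star S x) (\<rho> K ?J w) = \<rho> K (star S x) w"
    using K J star_Int_cat by (intro \<rho>_comp) auto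
  moreover have "\<rho> K ?J w \<in> F ?J"
    using K J by (intro \<rho>_closed) auto
  ultimately have "inv_into (F ?J) (\<rho> ?J (star S x)) (\<rho> K (star S x) w) = \<rho> K ?J w"
    using \<rho>_star_bij[OF I] by (metis bij_betw_def inv_into_f_f)
  moreover have "\<rho> ?J I (\<rho> K ?J w) = \<rho> K I w"
    using K J I by (intro \<rho>_comp) auto
  ultimately show ?thesis
    using I by (simp add: germ_def)
qed

lemma star_lift:
  assumes "I \<in> Int_cat" "x \<in> I" "b \<in> F (star S x)"
  obtains w where "w \<in> F (I \<inter> star S x)" "\<rho> (I \<inter> star S x) (star S x) w = b"
proof -
  have "b \<in> \<rho> (I \<inter> star S x) (star S x) ` F (I \<inter> star S x)"
    using \<rho>_star_bij[OF assms(1,2)] assms(3) by (simp add: bij_betw_def)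
  then show ?thesis
    using that by auto
qed

lemma germ_star:
  assumes "b \<in> F (star S x)"
  shows "germ x b (star S x) = b"
  using germ_\<rho>[OF star_Int_cat mem_star star_Int_cat order_refl order_refl assms]
    \<rho>_id[OF star_Int_cat assms]
  by simp

text \<open>One lift of \<open>b\<close> over \<open>I \<inter> star S x\<close> computes the germ
  on \<open>I\<close> and on every larger \<open>J\<close>, so compatibility is
  functoriality.\<close>

lemma germ_in_costalk:
  assumes b: "b \<in> F (star S x)"
  shows "germ x b \<in> costalk F \<rho> x"
proof -
  have "germ x b I \<in> F I" if I: "I \<in> Int_cat" "x \<in> I" for I
  proof -
    obtain w where w: "w \<in> F (I \<inter> star S x)" "\<rho> (I \<inter> star S x) (star S x) w = b"
      using I b by (rule star_lift)
    have "germ x b I = \<rho> (I \<inter> star S x) I w"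
      using germ_\<rho>[OF I star_Int_in_Int_cat[OF I] _ _ w(1)] w(2) by simp
    then show ?thesis
      using I w star_Int_in_Int_cat[OF I] by (auto intro: \<rho>_closed)
  qed
  then have "germ x b \<in> (\<Pi>\<^sub>E I\<in>{I \<in> Int_cat. x \<in> I}. F I)"
    by (auto simp: PiE_iff germ_def)
  moreover have "\<rho> I J (germ x b I) = germ x b J"
    if I: "I \<in> Int_cat" "x \<in> I" and J: "J \<in> Int_cat" "I \<subseteq> J" for I J
  proof -
    let ?K = "I \<inter> star S x"
    have K: "?K \<in> Int_cat"
      using I by (rule star_Int_in_Int_cat)
    obtain w where w: "w \<in> F ?K" "\<rho> ?K (star S x) w = b"
      using I b by (rule star_lift)
    have "germ x b I = \<rho> ?K I w" "germ x b J = \<rho> ?K J w"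
      using germ_\<rho>[OF _ _ K _ _ w(1)] I J w(2) by auto
    moreover have "\<rho> I J (\<rho> ?K I w) = \<rho> ?K J w"
      using K I J w by (intro \<rho>_comp) auto
    ultimately show ?thesis by simp
  qed
  ultimately show ?thesis
    by (simp add: costalk_def)
qed

lemma costalk_eqI:
  assumes s: "s \<in> costalk F \<rho> x" and t: "t \<in> costalk F \<rho> x"
    and eq: "s (star S x) = t (star S x)"
  shows "s = t"
proof (rule PiE_ext)
  show "s \<in> (\<Pi>\<^sub>E I\<in>{I \<in> Int_cat. x \<in> I}. F I)" "t \<in> (\<Pi>\<^sub>E I\<in>{I \<in> Int_cat. x \<in> I}. F I)"
    using s t by (auto simp: costalk_def)
  fix I
  assume "I \<in> {I \<in> Int_cat. x \<in> I}"
  then have I: "I \<in> Int_cat" "x \<in> I" by auto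
  let ?J = "I \<inter> star S x"
  have J: "?J \<in> Int_cat" "x \<in> ?J"
    using I star_Int_in_Int_cat by auto
  have u: "u ?J \<in> F ?J" "\<rho> ?J (star S x) (u ?J) = u (star S x)" "\<rho> ?J I (u ?J) = u I"
    if "u \<in> costalk F \<rho> x" for u
    using that I J star_Int_cat by (auto simp: costalk_def dest: PiE_mem)
  have "s ?J = t ?J"
    using \<rho>_star_bij[OF I] u[OF s] u[OF t] eq by (metis bij_betw_def inj_onD)
  then show "s I = t I"
    using u(3)[OF s] u(3)[OF t] by simp
qed

lemma costalk_eq_germ:
  assumes "s \<in> costalk F \<rho> x"
  shows "s (star S x) \<in> F (star S x)" "germ x (s (star S x)) = s"
proof -
  show *: "s (star S x) \<in> F (star S x)"
    using assms star_Int_cat by (auto simp: costalk_def dest: PiE_mem)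
  show "germ x (s (star S x)) = s"
    using germ_in_costalk[OF *] assms germ_star[OF *] by (rule costalk_eqI)
qed

lemma edge_Int_in_Int_cat:
  assumes "V \<in> edge_intervals S" "I \<in> Int_cat" "x \<in> closure V" "x \<in> I"
  shows "V \<inter> I \<in> Int_cat"
  using assms edge_meets_open[of x V I] edge_Int_cat
  by (intro Int_in_Int_cat) (auto simp: Int_cat_def)

text \<open>The right-hand side does not depend on \<open>x\<close>, so an edge path lies in a basic open set over
  \<open>I\<close> either on all of \<open>closure V \<inter> I\<close> or nowhere.\<close>

lemma germ_edge:
  assumes V: "V \<in> edge_intervals S" "a \<in> F V" and I: "I \<in> Int_cat" and x: "x \<in> closure V" "x \<in> I"
  shows "germ x (\<rho> V (star S x) a) I =
    \<rho> (V \<inter> I) I (inv_into (F (V \<inter> I)) (\<rho> (V \<inter> I) V) a)"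
proof -
  have VI: "V \<inter> I \<in> Int_cat"
    using edge_Int_in_Int_cat V I x by blast
  have sub: "V \<subseteq> star S x"
    using edge_subset_star_closure[OF finite_S V(1) x(1)] by simp
  define w where "w = inv_into (F (V \<inter> I)) (\<rho> (V \<inter> I) V) a"
  have "bij_betw (\<rho> (V \<inter> I) V) (F (V \<inter> I)) (F V)"
    using VI edge_Int_cat[OF V(1)] edge_Int_critical[OF V(1)] by (intro \<rho>_bij) auto
  then have w: "w \<in> F (V \<inter> I)" "\<rho> (V \<inter> I) V w = a"
    using V(2) unfolding w_def bij_betw_def by (auto intro: inv_into_into f_inv_into_f)
  have "\<rho> V (star S x) a = \<rho> (V \<inter> I) (star S x) w"
    using \<rho>_comp[OF VI edge_Int_cat[OF V(1)] star_Int_cat _ sub w(1)] w(2) by simp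
  then show ?thesis
    using germ_\<rho>[OF I x(2) VI _ _ w(1)] sub unfolding w_def by auto
qed

text \<open>A point \<open>c\<close> is a set of pre-points, so its fibre value has to be recovered
  by a description; \<open>point_inj\<close> makes it unique.\<close>

definition to_display :: "'a pre_point set \<Rightarrow> real \<times> (real set \<Rightarrow> 'a)"
  where "to_display c = (realization_proj c,
    germ (realization_proj c) (THE b. c = point (realization_proj c) b \<and>
      b \<in> F (star S (realization_proj c))))"

lemma to_display_point:
  assumes "b \<in> F (star S x)"
  shows "to_display (point x b) = (x, germ x b)"
proof -
  have "(THE b'. point x b = point x b' \<and> b' \<in> F (star S x)) = b"
    using assms point_inj(2)[OF assms, of x] by (intro the_equality) auto
  then show ?thesis
    using realization_proj_point[OF assms] by (simp add: to_display_def)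
qed

lemma to_display_in:
  assumes "b \<in> F (star S x)"
  shows "(x, germ x b) \<in> display_points F \<rho>"
  using germ_in_costalk[OF assms] by (simp add: display_points_def)

text \<open>Evaluating a compatible family at \<open>star S x\<close> undoes
  \<open>germ\<close>.\<close>

lemma bij_to_display:
  "bij_betw to_display (topspace (realization F \<rho> S)) (topspace (display_locale F \<rho>))"
  unfolding bij_betw_def
proof
  show "inj_on to_display (topspace (realization F \<rho> S))"
  proof (rule inj_onI)
    fix p q
    assume "p \<in> topspace (realization F \<rho> S)" "q \<in> topspace (realization F \<rho> S)"
      and eq: "to_display p = to_display q"
    then obtain x b y c where p: "p = point x b" "b \<in> F (star S x)"
      and q: "q = point y c" "c \<in> F (star S y)"
      unfolding topspace_realization by auto
    then have "x = y" "germ x b = germ x c"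
      using eq by (auto simp: to_display_point)
    then show "p = q"
      using germ_star[OF p(2)] germ_star[of c x] p q by simp
  qed
  show "to_display ` topspace (realization F \<rho> S) = topspace (display_locale F \<rho>)"
    unfolding topspace_display_locale
  proof (intro subset_antisym subsetI)
    fix d
    assume "d \<in> display_points F \<rho>"
    then obtain x s where d: "d = (x, s)" "s \<in> costalk F \<rho> x"
      by (auto simp: display_points_def)
    then have "d = to_display (point x (s (star S x)))"
      using costalk_eq_germ[OF d(2)] to_display_point by simp
    then show "d \<in> to_display ` topspace (realization F \<rho> S)"
      using costalk_eq_germ(1)[OF d(2)] point_in_topspace by blast
  next
    fix d
    assume "d \<in> to_display ` topspace (realization F \<rho> S)"
    then show "d \<in> display_points F \<rho>"
      unfolding topspace_realization using to_display_point to_display_in by auto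
  qed
qed

lemma continuous_to_display:
  "continuous_map (realization F \<rho> S) (display_locale F \<rho>) to_display"
  unfolding display_locale_def
proof (rule continuous_on_generated_topo)
  let ?B = "{display_open F \<rho> I a | I a. I \<in> Int_cat \<and> a \<in> F I}"
  show "to_display ` topspace (realization F \<rho> S) \<subseteq> \<Union>?B"
    using bij_to_display topspace_display_locale[of F \<rho>]
    unfolding bij_betw_def display_locale_def topology_generated_by_topspace by simp
  fix U
  assume "U \<in> ?B"
  then obtain I a where U: "U = display_open F \<rho> I a" and I: "I \<in> Int_cat"
    by blast
  show "openin (realization F \<rho> S) (to_display -` U \<inter> topspace (realization F \<rho> S))"
    unfolding openin_realization
  proof (intro conjI ballI)
    fix V v
    assume V: "V \<in> edge_intervals S" "v \<in> F V"
    \<comment> \<open>Apart from \<open>x \<in> I\<close>, the condition supplied by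
      \<open>germ_edge\<close> is free of \<open>x\<close>, so the preimage along the path is the
      trace of \<open>I\<close> or empty.\<close>
    have "edge_path V v x \<in> to_display -` U \<inter> topspace (realization F \<rho> S) \<longleftrightarrow>
        x \<in> I \<and> \<rho> (V \<inter> I) I (inv_into (F (V \<inter> I)) (\<rho> (V \<inter> I) V) v) = a"
      if x: "x \<in> closure V" for x
    proof -
      have "edge_path V v x \<in> to_display -` U \<inter> topspace (realization F \<rho> S) \<longleftrightarrow>
          x \<in> I \<and> germ x (\<rho> V (star S x) v) I = a"
        using edge_path_in_topspace[OF V x] edge_value_in[OF V x] to_display_in
        by (auto simp: U edge_path_def to_display_point display_open_def)
      then show ?thesis
        using germ_edge[OF V I x] by auto
    qed
    then have "{x \<in> closure V. edge_path V v x \<in>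
        to_display -` U \<inter> topspace (realization F \<rho> S)} =
        closure V \<inter> (if \<rho> (V \<inter> I) I (inv_into (F (V \<inter> I)) (\<rho> (V \<inter> I) V) v) = a then I else {})"
      by auto
    then show "openin (top_of_set (closure V)) {x \<in> closure V. edge_path V v x \<in>
        to_display -` U \<inter> topspace (realization F \<rho> S)}"
      using I by (auto simp: Int_cat_def openin_open_Int)
  qed auto
qed

section \<open>Edges adjacent to a point, and openness of the comparison map\<close>

lemma star_side:
  assumes "y \<in> star S x" "z \<in> star S x" "y < x \<and> z < x \<or> x < y \<and> x < z"
  shows "star S y = star S z"
proof -
  have "closed_segment y z \<subseteq> star S x" "x \<notin> closed_segment y z"
    using assms star_connected[of S x] connected_contains_Icc[of "star S x"]
    by (auto simp: closed_segment_eq_real_ivl)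
  \<comment> \<open>A critical value in \<open>star S x\<close> would have to be \<open>x\<close>,
    which is not between \<open>y\<close> and \<open>z\<close>.\<close>
  then have "closed_segment y z \<inter> S = {}"
    using star_critical[of _ S x] by blast
  then have "closed_segment y z \<subseteq> star S y"
    by (intro star_maximal) auto
  moreover have "y \<notin> S"
    using assms star_critical by auto
  ultimately show ?thesis
    using star_eq[of z S y] ends_in_segment(2)[of z y] by blast
qed

text \<open>All points strictly between \<open>x\<close> and \<open>y\<close> lie on one side of
  \<open>x\<close> and thus in the star of \<open>y\<close>; they accumulate at
  \<open>x\<close>.\<close>

lemma closure_star_side:
  assumes "y \<in> star S x" "y \<noteq> x"
  shows "x \<in> closure (star S y)"
proof -
  have "open_segment x y \<subseteq> star S y"
  proof
    fix z
    assume z: "z \<in> open_segment x y"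
    then have "z \<in> star S x"
      using assms(1) star_connected[of S x] connected_contains_Icc[of "star S x" x y]
        connected_contains_Icc[of "star S x" y x]
      by (auto simp: open_segment_eq_real_ivl split: if_splits)
    moreover have "y < x \<and> z < x \<or> x < y \<and> x < z"
      using z by (auto simp: open_segment_eq_real_ivl split: if_splits)
    ultimately have "star S y = star S z"
      using assms star_side by blast
    then show "z \<in> star S y"
      using mem_star[of z S] by simp
  qed
  then have "closure (open_segment x y) \<subseteq> closure (star S y)"
    by (rule closure_mono)
  then show ?thesis
    using assms(2) by auto
qed

text \<open>By \<open>star_side\<close> there is at most one edge on either side of
  \<open>x\<close>.\<close>

lemma finite_adjacent_edges: "finite (star S ` (star S x - {x}))"
proof -
  have *: "finite (star S ` A)" if "\<And>y z. y \<in> A \<Longrightarrow> z \<in> A \<Longrightarrow> star S y = star S z" for A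
  proof (cases "A = {}")
    case False
    then obtain y where "y \<in> A" by blast
    then have "star S ` A \<subseteq> {star S y}"
      using that by blast
    then show ?thesis
      using finite_subset by blast
  qed simp
  have "star S ` (star S x - {x}) =
      star S ` {y \<in> star S x. y < x} \<union> star S ` {y \<in> star S x. x < y}"
    by (auto simp: image_iff) (metis linorder_neqE_linordered_idom)
  moreover have "finite (star S ` {y \<in> star S x. y < x})" "finite (star S ` {y \<in> star S x. x < y})"
    by (rule *; rule star_side[of _ x]; simp)+
  ultimately show ?thesis
    by simp
qed

text \<open>Extends finite valence to all \<open>x\<close>: off \<open>S\<close> the edge
  \<open>V\<close> is the star itself and the map is the identity, so the fibre has at most one
  element.\<close>

lemma finite_edge_fibre:
  assumes "finite_valence F \<rho> S" "V \<in> edge_intervals S" "V \<subseteq> star S x" "b \<in> F (star S x)"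
  shows "finite {a \<in> F V. \<rho> V (star S x) a = b}"
proof (cases "x \<in> S")
  case True
  then show ?thesis
    using assms(1)[unfolded finite_valence_def, rule_format, OF True assms(2)] assms(3,4)
    by (simp add: crit_interval_eq_star[OF finite_S True])
next
  case False
  obtain v where "v \<in> V"
    using edge_Int_cat[OF assms(2)] by (auto simp: Int_cat_def)
  then have "V = star S x"
    using star_eq[of v S x] edge_interval_eq_star(1)[OF assms(2)] assms(3) False by auto
  then have "{a \<in> F V. \<rho> V (star S x) a = b} \<subseteq> {b}"
    using \<rho>_id[OF star_Int_cat] by auto
  then show ?thesis
    using finite_subset by blast
qed

text \<open>An open \<open>V\<close> has a point other than \<open>x\<close>, and the star of that
  point is \<open>V\<close>.\<close>

lemma edge_adjacent:
  assumes "V \<in> edge_intervals S" "x \<in> closure V"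
  shows "V \<in> star S ` (star S x - {x})"
proof -
  have V: "open V" "V \<noteq> {}"
    using edge_Int_cat[OF assms(1)] by (auto simp: Int_cat_def)
  then have "V \<noteq> {x}"
    using not_open_singleton by metis
  then obtain v where "v \<in> V" "v \<noteq> x"
    using V(2) by blast
  moreover have "V \<subseteq> star S x"
    using edge_subset_star_closure[OF finite_S assms mem_star] .
  ultimately show ?thesis
    using edge_interval_eq_star(1)[OF assms(1)] by (intro image_eqI[of _ _ v]) auto
qed

text \<open>Finite valence makes the intersection of the neighbourhoods contributed by the adjacent
  edges open.\<close>

lemma neighbourhood_interval:
  assumes fv: "finite_valence F \<rho> S" and U: "openin (realization F \<rho> S) U"
    and b: "b \<in> F (star S x)" "point x b \<in> U"
  obtains I where "I \<in> Int_cat" "x \<in> I" "I \<subseteq> star S x"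
    "\<And>y c. y \<in> I \<Longrightarrow> c \<in> F (star S y) \<Longrightarrow> \<rho> (star S y) (star S x) c = b \<Longrightarrow> point y c \<in> U"
proof -
  \<comment> \<open>The pairs in \<open>Sigma E A\<close> are the edge paths that pass through or
    end at \<open>point x b\<close>.\<close>
  define E where "E = {V \<in> edge_intervals S. x \<in> closure V}"
  define A where "A V = {a \<in> F V. \<rho> V (star S x) a = b}" for V
  have "finite E"
    by (rule finite_subset[OF _ finite_adjacent_edges[of x]]) (use edge_adjacent in \<open>auto simp: E_def\<close>)
  moreover have "finite (A V)" if "V \<in> E" for V
    unfolding A_def using fv that edge_subset_star_closure[OF finite_S _ _ mem_star] b(1)
    by (intro finite_edge_fibre) (auto simp: E_def)
  ultimately have fin: "finite (Sigma E A)"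
    by blast
  have "\<exists>N. open N \<and> x \<in> N \<and> (\<forall>y \<in> closure V \<inter> N. edge_path V a y \<in> U)"
    if Va: "V \<in> E" "a \<in> A V" for V a
  proof -
    have "openin (top_of_set (closure V)) {y \<in> closure V. edge_path V a y \<in> U}"
      using U Va unfolding openin_realization E_def A_def by simp
    then obtain N where N: "open N" "{y \<in> closure V. edge_path V a y \<in> U} = closure V \<inter> N"
      unfolding openin_open by metis
    moreover have "x \<in> {y \<in> closure V. edge_path V a y \<in> U}"
      using Va b by (simp add: E_def A_def edge_path_def)
    ultimately show ?thesis
      by (intro exI[of _ N]) blast
  qed
  then obtain N where N: "\<And>V a. V \<in> E \<Longrightarrow> a \<in> A V \<Longrightarrow> open (N V a)"
    "\<And>V a. V \<in> E \<Longrightarrow> a \<in> A V \<Longrightarrow> x \<in> N V a"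
    "\<And>V a y. V \<in> E \<Longrightarrow> a \<in> A V \<Longrightarrow> y \<in> closure V \<inter> N V a \<Longrightarrow> edge_path V a y \<in> U"
    by metis
  have "open (star S x \<inter> (\<Inter>(V, a)\<in>Sigma E A. N V a))"
    using star_Int_cat[of x] N(1) fin by (intro open_Int open_INT) (auto simp: Int_cat_def)
  moreover have "x \<in> star S x \<inter> (\<Inter>(V, a)\<in>Sigma E A. N V a)"
    using N(2) by auto
  ultimately obtain e where e: "e > 0" "ball x e \<subseteq> star S x \<inter> (\<Inter>(V, a)\<in>Sigma E A. N V a)"
    by (meson openE)
  show ?thesis
  proof (rule that[of "ball x e"])
    show "ball x e \<in> Int_cat" "x \<in> ball x e" "ball x e \<subseteq> star S x"
      using e by (auto simp: Int_cat_def)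
    fix y c
    assume y: "y \<in> ball x e" and c: "c \<in> F (star S y)" "\<rho> (star S y) (star S x) c = b"
    show "point y c \<in> U"
    proof (cases "y = x")
      case True
      then show ?thesis
        using c b \<rho>_id[OF star_Int_cat] by simp
    next
      case False
      have ys: "y \<in> star S x"
        using e(2) y by blast
      then have "y \<notin> S"
        using False star_critical by blast
      then have edge: "star S y \<in> edge_intervals S"
        by (rule star_in_edge_intervals)
      \<comment> \<open>The edge through \<open>point y c\<close> reaches \<open>x\<close> and its
        value maps to \<open>b\<close>, so its neighbourhood was one of those intersected.\<close>
      have "star S y \<in> E"
        using edge closure_star_side[OF ys False] by (simp add: E_def)
      moreover have "c \<in> A (star S y)"
        using c by (simp add: A_def)
      moreover have "y \<in> closure (star S y)"
        using closure_subset mem_star by blast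
      moreover have "y \<in> N (star S y) c"
        using e(2) y calculation(1,2) by blast
      ultimately have "edge_path (star S y) c y \<in> U"
        using N(3) by blast
      then show ?thesis
        using fibre_value_edge[OF edge mem_star c(1)] by (simp add: edge_path_def)
    qed
  qed
qed

lemma open_map_to_display:
  assumes "finite_valence F \<rho> S"
  shows "open_map (realization F \<rho> S) (display_locale F \<rho>) to_display"
  unfolding open_map_def
proof (intro allI impI)
  fix U
  assume U: "openin (realization F \<rho> S) U"
  have "\<exists>T. openin (display_locale F \<rho>) T \<and> d \<in> T \<and> T \<subseteq> to_display ` U"
    if d: "d \<in> to_display ` U" for d
  proof -
    obtain p where p: "p \<in> U" "d = to_display p"
      using d by blast
    moreover have "p \<in> topspace (realization F \<rho> S)"
      using openin_subset[OF U] p(1) by blast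
    ultimately obtain x b where b: "b \<in> F (star S x)" "point x b \<in> U" "d = (x, germ x b)"
      unfolding topspace_realization using to_display_point by auto
    obtain I where I: "I \<in> Int_cat" "x \<in> I" "I \<subseteq> star S x" and IU:
      "\<And>y c. y \<in> I \<Longrightarrow> c \<in> F (star S y) \<Longrightarrow> \<rho> (star S y) (star S x) c = b \<Longrightarrow> point y c \<in> U"
      using neighbourhood_interval[OF assms U b(1,2)] by blast
    \<comment> \<open>The lift \<open>w\<close> of \<open>b\<close> to \<open>I\<close> defines the
      basic neighbourhood of \<open>d\<close>. A family with value \<open>w\<close> over
      \<open>I\<close> has value \<open>b\<close> over \<open>star S x\<close>, which is the
      hypothesis of \<open>IU\<close>.\<close>
    obtain w where "w \<in> F (I \<inter> star S x)" "\<rho> (I \<inter> star S x) (star S x) w = b"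
      using I(1,2) b(1) by (rule star_lift)
    then have w: "w \<in> F I" "\<rho> I (star S x) w = b"
      using I(3) by (simp_all add: Int_absorb2)
    show ?thesis
    proof (intro exI conjI)
      show "openin (display_locale F \<rho>) (display_open F \<rho> I w)"
        unfolding display_locale_def using I(1) w(1) by (intro topology_generated_by_Basis) blast
      have "germ x b I = w"
        using germ_\<rho>[OF I(1,2,1) order_refl I(3) w(1)] w \<rho>_id[OF I(1)] by simp
      then show "d \<in> display_open F \<rho> I w"
        using b I(2) to_display_in by (simp add: display_open_def)
      show "display_open F \<rho> I w \<subseteq> to_display ` U"
      proof
        fix q
        assume "q \<in> display_open F \<rho> I w"
        then obtain y s where q: "q = (y, s)" "s \<in> costalk F \<rho> y" "y \<in> I" "s I = w"
          by (auto simp: display_open_def display_points_def)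
        have compat: "\<rho> K (star S x) (s K) = s (star S x)"
          if "K \<in> Int_cat" "y \<in> K" "K \<subseteq> star S x" for K
          using q(2) that star_Int_cat by (simp add: costalk_def)
        have "star S y \<subseteq> star S x"
          using q(3) I(3) star_mono by blast
        then have "\<rho> (star S y) (star S x) (s (star S y)) = b"
          \<comment> \<open>Both \<open>star S y\<close> and \<open>I\<close> contain
            \<open>y\<close> and lie in \<open>star S x\<close>, so the values of \<open>s\<close>
            over them have the same image there, and that of \<open>w\<close> is
            \<open>b\<close>.\<close>
          using compat[OF star_Int_cat mem_star] compat[OF I(1) q(3) I(3)] q(4) w(2) by simp
        then have "point y (s (star S y)) \<in> U"
          using IU q(3) costalk_eq_germ(1)[OF q(2)] by blast
        moreover have "q = to_display (point y (s (star S y)))"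
          using costalk_eq_germ[OF q(2)] q(1) to_display_point by simp
        ultimately show "q \<in> to_display ` U"
          by blast
      qed
    qed
  qed
  then show "openin (display_locale F \<rho>) (to_display ` U)"
    by (subst openin_subopen) blast
qed

lemma R_space_isomorphic_display:
  assumes "finite_valence F \<rho> S"
  shows "R_space_isomorphic (realization F \<rho> S) realization_proj (display_locale F \<rho>) fst"
proof -
  have homeo: "homeomorphic_map (realization F \<rho> S) (display_locale F \<rho>) to_display"
    using continuous_to_display open_map_to_display[OF assms] bij_to_display
    by (intro bijective_open_imp_homeomorphic_map) (auto simp: bij_betw_def)
  have fst: "fst (to_display c) = realization_proj c" for c
    by (simp add: to_display_def)
  obtain g where g: "homeomorphic_maps (realization F \<rho> S) (display_locale F \<rho>) to_display g"
    using homeo homeomorphic_map_maps by blast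
  \<comment> \<open>Continuity of the projection is transported along the inverse
    homeomorphism.\<close>
  have "continuous_map (display_locale F \<rho>) euclideanreal fst"
  proof (rule continuous_map_eq)
    show "continuous_map (display_locale F \<rho>) euclideanreal (realization_proj \<circ> g)"
      using g continuous_realization_proj unfolding homeomorphic_maps_def
      by (blast intro: continuous_map_compose)
    show "\<And>d. d \<in> topspace (display_locale F \<rho>) \<Longrightarrow> (realization_proj \<circ> g) d = fst d"
      using g fst unfolding homeomorphic_maps_def by (metis comp_apply)
  qed
  then show ?thesis
    unfolding R_space_isomorphic_def R_space_def
    using homeo fst continuous_realization_proj by blast
qed

section \<open>The cells of the realization\<close>

text \<open>Unbounded edges are not cells, so the integers are added as vertices.\<close>

definition vertices :: "real set"
  where "vertices = S \<union> \<int>"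

definition gap :: "real \<Rightarrow> real \<Rightarrow> bool"
  where "gap l r \<longleftrightarrow> l < r \<and> l \<in> vertices \<and> r \<in> vertices \<and> {l<..<r} \<inter> vertices = {}"

definition cells :: "'a pre_point set set set"
  where "cells = {{point x b} | x b. x \<in> vertices \<and> b \<in> F (star S x)} \<union>
    {edge_path V a ` {l<..<r} | V a l r.
      gap l r \<and> V \<in> edge_intervals S \<and> a \<in> F V \<and> {l<..<r} \<subseteq> V}"

lemma finite_vertices_Icc: "finite (vertices \<inter> {a..b})"
proof -
  have "finite (\<int> \<inter> {a..b})"
    by (rule finite_subset[OF _ finite_imageI[OF finite_atLeastAtMost_int[of "\<lceil>a\<rceil>" "\<lfloor>b\<rfloor>"]], of _ real_of_int])
      (auto simp: Ints_def ceiling_le_iff le_floor_iff)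
  then show ?thesis
    using finite_S by (simp add: vertices_def Int_Un_distrib2)
qed

lemma previous_vertex:
  obtains l where "l < x" "l \<in> vertices" "{l<..<x} \<inter> vertices = {}"
proof -
  \<comment> \<open>The integer \<lceil>x\<rceil> - 1 is strictly below \<open>x\<close> even if
    \<open>x\<close> is an integer, so the finite set \<open>?A\<close> is nonempty and its maximum
    is the wanted vertex.\<close>
  let ?A = "vertices \<inter> {of_int (\<lceil>x\<rceil> - 1)..x} - {x}"
  have fin: "finite ?A"
    using finite_vertices_Icc by blast
  have n: "of_int (\<lceil>x\<rceil> - 1) < x" "of_int (\<lceil>x\<rceil> - 1) \<in> vertices"
    unfolding vertices_def by linarith auto
  then have "of_int (\<lceil>x\<rceil> - 1) \<in> ?A"
    by (simp del: of_int_diff)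
  then have ne: "?A \<noteq> {}" by blast
  define m where "m = Max ?A"
  have m: "m \<in> ?A"
    unfolding m_def using fin ne by (rule Max_in)
  have "y \<notin> vertices" if y: "y \<in> {m<..<x}" for y
  proof
    assume "y \<in> vertices"
    then have "y \<in> ?A"
      using y m by (simp del: of_int_add of_int_diff)
    then show False
      using Max_ge[OF fin] y unfolding m_def by fastforce
  qed
  then have "{m<..<x} \<inter> vertices = {}"
    by blast
  moreover have "m < x" "m \<in> vertices"
    using m by auto
  ultimately show ?thesis
    using that by blast
qed

lemma next_vertex:
  obtains r where "x < r" "r \<in> vertices" "{x<..<r} \<inter> vertices = {}"
proof -
  let ?A = "vertices \<inter> {x..of_int (\<lfloor>x\<rfloor> + 1)} - {x}"
  have fin: "finite ?A"
    using finite_vertices_Icc by blast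
  have n: "x < of_int (\<lfloor>x\<rfloor> + 1)" "of_int (\<lfloor>x\<rfloor> + 1) \<in> vertices"
    unfolding vertices_def by linarith auto
  then have "of_int (\<lfloor>x\<rfloor> + 1) \<in> ?A"
    by (simp del: of_int_add)
  then have ne: "?A \<noteq> {}" by blast
  define m where "m = Min ?A"
  have m: "m \<in> ?A"
    unfolding m_def using fin ne by (rule Min_in)
  have "y \<notin> vertices" if y: "y \<in> {x<..<m}" for y
  proof
    assume "y \<in> vertices"
    then have "y \<in> ?A"
      using y m by (simp del: of_int_add of_int_diff)
    then show False
      using Min_le[OF fin] y unfolding m_def by fastforce
  qed
  then have "{x<..<m} \<inter> vertices = {}"
    by blast
  moreover have "x < m" "m \<in> vertices"
    using m by auto
  ultimately show ?thesis
    using that by blast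
qed

text \<open>If two overlapping gaps had different ends, an end of one would be a vertex strictly
  inside the other.\<close>

lemma gap_unique:
  assumes "gap l r" "gap l' r'" "t \<in> {l<..<r}" "t \<in> {l'<..<r'}"
  shows "l = l'" "r = r'"
proof -
  have *: "\<not> (u < v \<and> v < w)" if "gap u w" "v \<in> vertices" for u v w
    using that by (auto simp: gap_def)
  have "l \<in> vertices" "r \<in> vertices" "l' \<in> vertices" "r' \<in> vertices"
    using assms(1,2) by (auto simp: gap_def)
  then show "l = l'" "r = r'"
    using *[OF assms(1)] *[OF assms(2)] assms(3,4) by fastforce+
qed

lemma gap_star:
  assumes "gap l r" "t \<in> {l<..<r}"
  shows "t \<notin> S" "{l<..<r} \<subseteq> star S t"
proof -
  have "{l<..<r} \<inter> S = {}"
    using assms(1) by (auto simp: gap_def vertices_def)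
  then show "t \<notin> S" "{l<..<r} \<subseteq> star S t"
    using assms(2) star_maximal[of "{l<..<r}" t S] by auto
qed

lemma gap_edge_path:
  assumes "gap l r" "V \<in> edge_intervals S" "a \<in> F V" "{l<..<r} \<subseteq> V" "t \<in> {l..r}"
  shows "t \<in> closure V" "realization_proj (edge_path V a t) = t"
    "edge_path V a t \<in> topspace (realization F \<rho> S)"
proof -
  show "t \<in> closure V"
    using assms Icc_subset_closure[of l r V] by (auto simp: gap_def)
  then show "realization_proj (edge_path V a t) = t"
    "edge_path V a t \<in> topspace (realization F \<rho> S)"
    using assms realization_proj_edge_path edge_path_in_topspace by auto
qed

lemma edge_path_eq_point:
  assumes "V \<in> edge_intervals S" "a \<in> F V" "t \<in> V"
  shows "edge_path V a t = point t a"
  unfolding edge_path_def using fibre_value_edge[OF assms(1,3,2)] by simp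

section \<open>The cells partition the realization\<close>

lemma Union_cells: "\<Union>cells = topspace (realization F \<rho> S)"
proof (intro subset_antisym subsetI)
  fix p
  assume "p \<in> \<Union>cells"
  then consider x b where "p = point x b" "b \<in> F (star S x)"
    | V a l r t where "gap l r" "V \<in> edge_intervals S" "a \<in> F V" "{l<..<r} \<subseteq> V"
      "t \<in> {l<..<r}" "p = edge_path V a t"
    unfolding cells_def by blast
  then show "p \<in> topspace (realization F \<rho> S)"
  proof cases
    case 1
    then show ?thesis
      using point_in_topspace by simp
  next
    case (2 V a l r t)
    then show ?thesis
      using gap_edge_path(3)[OF 2(1-4), of t] by simp
  qed
next
  fix p
  assume "p \<in> topspace (realization F \<rho> S)"
  then obtain x b where p: "p = point x b" "b \<in> F (star S x)"
    unfolding topspace_realization by blast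
  show "p \<in> \<Union>cells"
  proof (cases "x \<in> vertices")
    case True
    then show ?thesis
      using p unfolding cells_def by blast
  next
    case False
    obtain l where l: "l < x" "l \<in> vertices" "{l<..<x} \<inter> vertices = {}"
      by (rule previous_vertex)
    obtain r where r: "x < r" "r \<in> vertices" "{x<..<r} \<inter> vertices = {}"
      by (rule next_vertex)
    have "{l<..<r} \<subseteq> {l<..<x} \<union> {x} \<union> {x<..<r}"
      by auto
    then have gap: "gap l r"
      using l r False unfolding gap_def by auto
    have x: "x \<in> {l<..<r}"
      using l r by simp
    have edge: "star S x \<in> edge_intervals S"
      using gap_star(1)[OF gap x] by (rule star_in_edge_intervals)
    have "p \<in> edge_path (star S x) b ` {l<..<r}"
      using edge_path_eq_point[OF edge p(2) mem_star] p(1) x by auto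
    moreover have "edge_path (star S x) b ` {l<..<r} \<in> cells"
      unfolding cells_def using gap edge p(2) gap_star(2)[OF gap x] by blast
    ultimately show ?thesis
      by blast
  qed
qed

text \<open>The projection tells the kinds of cells apart, since gaps contain no vertices, and it
  recovers the parameter of \<open>p\<close> on its arc.\<close>

lemma cells_cases:
  assumes "e \<in> cells" "p \<in> e"
  obtains (vertex) "realization_proj p \<in> vertices" "e = {p}"
  | (arc) V a l r where "gap l r" "V \<in> edge_intervals S" "a \<in> F V" "{l<..<r} \<subseteq> V"
      "realization_proj p \<in> {l<..<r}" "p = edge_path V a (realization_proj p)"
      "e = edge_path V a ` {l<..<r}" "realization_proj p \<notin> vertices"
proof -
  consider x b where "e = {point x b}" "x \<in> vertices" "b \<in> F (star S x)"
    | V a l r where "e = edge_path V a ` {l<..<r}" "gap l r" "V \<in> edge_intervals S" "a \<in> F V"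
      "{l<..<r} \<subseteq> V"
    using assms(1) unfolding cells_def by blast
  then show ?thesis
  proof cases
    case 1
    then show ?thesis
      using assms(2) realization_proj_point by (intro vertex) simp_all
  next
    case (2 V a l r)
    then obtain t where t: "t \<in> {l<..<r}" "p = edge_path V a t"
      using assms(2) by blast
    then have "realization_proj p = t"
      using gap_edge_path(2)[OF 2(2-5), of t] by simp
    moreover have "t \<notin> vertices"
      using 2(2) t(1) unfolding gap_def by blast
    ultimately show ?thesis
      using arc[OF 2(2-5) _ _ 2(1)] t by simp
  qed
qed

lemma disjoint_cells: "pairwise disjnt cells"
proof (rule pairwiseI)
  fix e e'
  assume e: "e \<in> cells" "e' \<in> cells" "e \<noteq> e'"
  show "disjnt e e'"
    unfolding disjnt_iff
  proof (intro allI notI, elim conjE)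
    fix p
    assume p: "p \<in> e" "p \<in> e'"
    let ?t = "realization_proj p"
    from e(1) p(1) show False
    proof (cases rule: cells_cases)
      case vertex
      from e(2) p(2) show ?thesis
        by (cases rule: cells_cases) (use vertex e(3) in simp_all)
    next
      case 1: (arc V a l r)
      from e(2) p(2) show ?thesis
      proof (cases rule: cells_cases)
        case vertex
        then show ?thesis
          using 1(8) by simp
      next
        case 2: (arc V' a' l' r')
        \<comment> \<open>The common point determines everything: \<open>?t\<close> gives the edge
          as its star, \<open>point_inj\<close> then gives the value, and \<open>gap_unique\<close>
          gives the ends.\<close>
        have t: "?t \<in> V" "?t \<in> V'"
          using 1(4,5) 2(4,5) by blast+
        have V: "V = star S ?t" "V' = star S ?t"
          using edge_interval_eq_star(1)[OF 1(2) t(1)] edge_interval_eq_star(1)[OF 2(2) t(2)]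
          by simp_all
        have "point ?t a = point ?t a'"
          using edge_path_eq_point[OF 1(2,3) t(1)] edge_path_eq_point[OF 2(2,3) t(2)] 1(6) 2(6)
          by simp
        then have "a = a'"
          using point_inj(2)[of a ?t ?t a'] 1(3) V(1) by simp
        moreover have "l = l'" "r = r'"
          using gap_unique[OF 1(1) 2(1) 1(5) 2(5)] .
        ultimately show ?thesis
          using V 1(7) 2(7) e(3) by simp
      qed
    qed
  qed
qed

lemma vertex_cell:
  assumes "V \<in> edge_intervals S" "a \<in> F V" "x \<in> closure V" "x \<in> vertices"
  shows "{edge_path V a x} \<in> cells"
  unfolding cells_def edge_path_def using assms(4) edge_value_in[OF assms(1-3)] by blast

text \<open>A gap without critical values lies inside \<open>V\<close> or misses it. If it misses
  \<open>V\<close>, at most the two ends remain. If it lies inside, its arc is a cell, and the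
  hypothesis on that cell is pulled back along the edge path.\<close>

lemma closed_preimage_gap:
  assumes A: "A \<subseteq> topspace (realization F \<rho> S)"
    "\<And>e. e \<in> cells \<Longrightarrow> closedin (realization F \<rho> S) (A \<inter> realization F \<rho> S closure_of e)"
    and V: "V \<in> edge_intervals S" "a \<in> F V" and gap: "gap l r"
  shows "closed ({x \<in> closure V. edge_path V a x \<in> A} \<inter> {l..r})"
proof (cases "{l<..<r} \<inter> V = {}")
  case True
  then have "{l<..<r} \<inter> closure V = {}"
    by (simp add: open_Int_closure_eq_empty)
  then have "{x \<in> closure V. edge_path V a x \<in> A} \<inter> {l..r} \<subseteq> {l, r}"
    by (auto simp: disjoint_iff) (metis less_eq_real_def)
  then show ?thesis
    by (meson finite.emptyI finite_imp_closed finite_insert finite_subset)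
next
  case False
  then obtain t where t: "t \<in> {l<..<r}" "t \<in> V" by blast
  have sub: "{l<..<r} \<subseteq> V"
    using gap_star(2)[OF gap t(1)] edge_interval_eq_star(1)[OF V(1) t(2)] by simp
  have lr: "l < r"
    using gap by (simp add: gap_def)
  let ?X = "realization F \<rho> S"
  let ?e = "edge_path V a ` {l<..<r}"
  have "?e \<in> cells"
    using gap V sub unfolding cells_def by blast
  then have "closedin (top_of_set (closure V))
      {x \<in> topspace (top_of_set (closure V)). edge_path V a x \<in> A \<inter> ?X closure_of ?e}"
    by (intro closedin_continuous_map_preimage[OF continuous_edge_path[OF V]] A(2))
  then have "closed {x \<in> closure V. edge_path V a x \<in> A \<inter> ?X closure_of ?e}"
    by (simp add: closedin_closed_eq)
  then have "closed ({x \<in> closure V. edge_path V a x \<in> A \<inter> ?X closure_of ?e} \<inter> {l..r})"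
    by (intro closed_Int) auto
  \<comment> \<open>By continuity the path maps \<open>{l..r}\<close>, the closure of the gap, into
    the closure of the cell, so over \<open>{l..r}\<close> intersecting with that closure changes
    nothing.\<close>
  moreover have "edge_path V a x \<in> ?X closure_of ?e" if "x \<in> {l..r}" for x
  proof -
    have Vc: "{l<..<r} \<subseteq> closure V" "{l..r} \<subseteq> closure V"
      using sub closure_subset Icc_subset_closure[OF lr sub] by blast+
    have "x \<in> top_of_set (closure V) closure_of {l<..<r}"
      using that Vc lr by (auto simp: closure_of_subtopology Int_absorb1)
    then show ?thesis
      using continuous_map_image_closure_subset[OF continuous_edge_path[OF V]] by blast
  qed
  then have "{x \<in> closure V. edge_path V a x \<in> A \<inter> ?X closure_of ?e} \<inter> {l..r} =
      {x \<in> closure V. edge_path V a x \<in> A} \<inter> {l..r}"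
    by blast
  ultimately show ?thesis by simp
qed

text \<open>Closedness is tested along each edge path. Every real is interior to one closed gap or
  to the union of two adjacent ones, so closedness over gaps suffices.\<close>

lemma weak_topology_cells:
  assumes A: "A \<subseteq> topspace (realization F \<rho> S)"
    "\<And>e. e \<in> cells \<Longrightarrow> closedin (realization F \<rho> S) (A \<inter> realization F \<rho> S closure_of e)"
  shows "closedin (realization F \<rho> S) A"
  unfolding closedin_realization
proof (intro conjI ballI A(1))
  fix V a
  assume V: "V \<in> edge_intervals S" "a \<in> F V"
  let ?B = "{x \<in> closure V. edge_path V a x \<in> A}"
  have gap_closed: "closed (?B \<inter> {l..r})" if "gap l r" for l r
    using A V that by (rule closed_preimage_gap)
  have "closed ?B"
  proof (rule closed_if_locally_closed_real)
    fix x
    obtain l where l: "l < x" "l \<in> vertices" "{l<..<x} \<inter> vertices = {}"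
      by (rule previous_vertex)
    obtain r where r: "x < r" "r \<in> vertices" "{x<..<r} \<inter> vertices = {}"
      by (rule next_vertex)
    have "closed (?B \<inter> {l..r})"
    proof (cases "x \<in> vertices")
      case True
      then have "gap l x" "gap x r"
        using l r by (auto simp: gap_def)
      then have "closed (?B \<inter> {l..x} \<union> ?B \<inter> {x..r})"
        by (intro closed_Un gap_closed)
      moreover have "?B \<inter> {l..x} \<union> ?B \<inter> {x..r} = ?B \<inter> {l..r}"
        using l(1) r(1) by auto
      ultimately show ?thesis by simp
    next
      case False
      have "{l<..<r} \<subseteq> {l<..<x} \<union> {x} \<union> {x<..<r}"
        by auto
      then have "gap l r"
        using l r False unfolding gap_def by auto
      then show ?thesis
        by (rule gap_closed)
    qed
    then show "\<exists>l r. l < x \<and> x < r \<and> closed (?B \<inter> {l..r})"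
      using l(1) r(1) by blast
  qed
  then show "closedin (top_of_set (closure V)) ?B"
    by (simp add: closedin_closed_eq)
qed

lemma cw_complex_realization: "cw_complex_of_dim 1 (realization F \<rho> S)"
proof (rule cw_complex_of_dim_1I[OF Hausdorff_realization Union_cells disjoint_cells
      continuous_realization_proj])
  fix e
  assume "e \<in> cells"
  then consider x b where "e = {point x b}"
    | V a l r where "e = edge_path V a ` {l<..<r}" "gap l r" "V \<in> edge_intervals S" "a \<in> F V"
      "{l<..<r} \<subseteq> V"
    unfolding cells_def by blast
  then show "(\<exists>c. e = {c}) \<or> (\<exists>l r \<gamma>. l < r \<and>
      continuous_map (top_of_set {l..r}) (realization F \<rho> S) \<gamma> \<and>
      (\<forall>t\<in>{l..r}. realization_proj (\<gamma> t) = t) \<and>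
      e = \<gamma> ` {l<..<r} \<and> {\<gamma> l} \<in> cells \<and> {\<gamma> r} \<in> cells)"
  proof cases
    case (2 V a l r)
    have lr: "l < r" "l \<in> vertices" "r \<in> vertices"
      using 2(2) by (auto simp: gap_def)
    have "continuous_map (top_of_set {l..r}) (realization F \<rho> S) (edge_path V a)"
      \<comment> \<open>The path of an edge is continuous on all of \<open>closure V\<close>, so its
        restriction covers the arc with both end vertices.\<close>
      using continuous_map_from_subtopology_mono[OF continuous_edge_path[OF 2(3,4)]
          Icc_subset_closure[OF lr(1) 2(5)]] .
    moreover have "{edge_path V a l} \<in> cells" "{edge_path V a r} \<in> cells"
      using vertex_cell[OF 2(3,4)] gap_edge_path(1)[OF 2(2-5)] lr by auto
    ultimately show ?thesis
      using 2 lr(1) gap_edge_path(2)[OF 2(2-5)]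
      by (intro disjI2 exI[of _ l] exI[of _ r] exI[of _ "edge_path V a"]) simp
  qed blast
qed (use weak_topology_cells in blast)

end

theorem proposition2p11:
  fixes F :: "real set \<Rightarrow> 'a set"
    and \<rho> :: "real set \<Rightarrow> real set \<Rightarrow> 'a \<Rightarrow> 'a"
    and S :: "real set"
  assumes "constructible_cosheaf F \<rho> S"
  shows "cw_complex_of_dim 1 (realization F \<rho> S) \<and>
    (finite_valence F \<rho> S \<longrightarrow>
      R_space_isomorphic (realization F \<rho> S) realization_proj (display_locale F \<rho>) fst)"
proof -
  interpret constructible_cosheaf_data F \<rho> S
    by standard (rule assms)
  show ?thesis
    using cw_complex_realization R_space_isomorphic_display by blast
qed

end
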